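(* Let $X$ be a locally compact Hausdorff space that is not compact. Consider the statements: (i) $X$ is metrizable, locally Euclidean, and has no isolated points; (ii) $X$ is metrizable and $\operatorname{Homeo}_{\overline U}(X)$ is not locally compact for every non-empty open set $U$ such that $\overline U$ is compact; (iii) $X$ is normal, locally metrizable, and contains (1) a compact subset $M_0$ such that $\operatorname{Homeo}_{M_0}(X)$ is not locally compact, and (2) an infinite discrete closed set $T$ such that for every $t\in T$ and every neighborhood $V$ of $t$ with compact closure, $\operatorname{Homeo}_{\overline V}(X)$ is not discrete; (iv) $X$ contains (1) a compact metrizable subset $M_0$ such that $\operatorname{Homeo}_{M_0}(X)$ is not locally compact, and (2) a regular closed, $\sigma$-compact, metrizable subset $A$ whose interior contains an infinite discrete closed set $T$ such that for every $t\in T$ and every neighborhood $V$ of $t$ with compact closure, $\operatorname{Homeo}_{\overline V}(X)$ is not discrete; (v) the family $\{\operatorname{Homeo}_K(X)\}_{K\in\mathscr K(X)}$ does not satisfy ACP. Then (i) $\Rightarrow$ (ii) $\Rightarrow$ (iii) $\Rightarrow$ (iv) $\Rightarrow$ (v).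
   Context: A space is locally Euclidean if every point has an open neighborhood homeomorphic to $\mathbb R^n$ for some $n$. A subset is regular closed if it equals the closure of its interior. For a compact subset $K$ of $X$, $\operatorname{Homeo}_K(X)$ denotes the group of homeomorphisms $h$ of $X$ with $h(x)=x$ for all $x\in X\setminus K$, with the compact-open topology (a topological group). $\mathscr K(X)$ is the set of compact subsets of $X$ ordered by inclusion, and the family has inclusions as bonding maps. For a directed family $\{G_\alpha\}$ of topological groups with inclusions that are closed embeddings as bonding maps and union $G$, the colimit space topology is $\mathscr T=\{U\subseteq G\mid U\cap G_\alpha\text{ open in }G_\alpha\ \forall\alpha\}$; the family satisfies ACP if $(G,\mathscr T)$ is a topological group (equivalently, $\mathscr T$ equals the finest group topology making all inclusions continuous). *)

theory Defs
  imports "HOL-Analysis.Analysis"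
begin

definition locally_euclidean_space :: "'a topology \<Rightarrow> bool" where
  "locally_euclidean_space X \<longleftrightarrow>
     (\<forall>x \<in> topspace X. \<exists>U n. openin X U \<and> x \<in> U \<and>
        subtopology X U homeomorphic_space Euclidean_space n)"

definition locally_metrizable_space :: "'a topology \<Rightarrow> bool" where
  "locally_metrizable_space X \<longleftrightarrow>
     (\<forall>x \<in> topspace X. \<exists>U. openin X U \<and> x \<in> U \<and> metrizable_space (subtopology X U))"

definition no_isolated_points :: "'a topology \<Rightarrow> bool" where
  "no_isolated_points X \<longleftrightarrow> (\<forall>x \<in> topspace X. \<not> openin X {x})"

definition neighbourhood_of :: "'a topology \<Rightarrow> 'a set \<Rightarrow> 'a \<Rightarrow> bool" where
  "neighbourhood_of X V x \<longleftrightarrow> V \<subseteq> topspace X \<and> (\<exists>W. openin X W \<and> x \<in> W \<and> W \<subseteq> V)"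

definition sigma_compact_in :: "'a topology \<Rightarrow> 'a set \<Rightarrow> bool" where
  "sigma_compact_in X A \<longleftrightarrow> (\<exists>C :: nat \<Rightarrow> 'a set. (\<forall>n. compactin X (C n)) \<and> A = (\<Union>n. C n))"

definition regular_closed_in :: "'a topology \<Rightarrow> 'a set \<Rightarrow> bool" where
  "regular_closed_in X A \<longleftrightarrow> X closure_of (X interior_of A) = A"

definition infinite_discrete_closed_in :: "'a topology \<Rightarrow> 'a set \<Rightarrow> bool" where
  "infinite_discrete_closed_in X T \<longleftrightarrow>
     closedin X T \<and> infinite T \<and> subtopology X T = discrete_topology T"

text \<open>Homeo_K(X): homeomorphisms of X fixing every point outside K (as functions on the whole
  type, they are the identity outside K, in particular outside topspace X).\<close>
definition Homeo :: "'a topology \<Rightarrow> 'a set \<Rightarrow> ('a \<Rightarrow> 'a) set" where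
  "Homeo X K = {h. homeomorphic_map X X h \<and> (\<forall>x. x \<notin> K \<longrightarrow> h x = x)}"

definition compact_open_topology :: "'a topology \<Rightarrow> ('a \<Rightarrow> 'a) set \<Rightarrow> ('a \<Rightarrow> 'a) topology" where
  "compact_open_topology X G =
     subtopology
       (topology_generated_by {{h. h ` C \<subseteq> U} | C U. compactin X C \<and> openin X U})
       G"

definition Homeo_top :: "'a topology \<Rightarrow> 'a set \<Rightarrow> ('a \<Rightarrow> 'a) topology" where
  "Homeo_top X K = compact_open_topology X (Homeo X K)"

definition colimit_topology :: "'i set \<Rightarrow> ('i \<Rightarrow> 'g topology) \<Rightarrow> 'g topology" where
  "colimit_topology I T =
     topology (\<lambda>U. U \<subseteq> (\<Union>i\<in>I. topspace (T i)) \<and> (\<forall>i\<in>I. openin (T i) (U \<inter> topspace (T i))))"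

text \<open>A topology on a group of bijections of the type, with composition as product and
  inverse function as inverse, makes it a topological group.\<close>
definition topological_group_of_maps :: "('a \<Rightarrow> 'a) topology \<Rightarrow> bool" where
  "topological_group_of_maps T \<longleftrightarrow>
     continuous_map (prod_topology T T) T (\<lambda>p. fst p \<circ> snd p) \<and>
     continuous_map T T (\<lambda>h. inv h)"

definition Homeo_family_ACP :: "'a topology \<Rightarrow> bool" where
  "Homeo_family_ACP X \<longleftrightarrow>
     topological_group_of_maps (colimit_topology {K. compactin X K} (Homeo_top X))"

end

theory Submission
  imports Defs
begin

text \<open>
  (iv) implies (v). For a compact metrizable \<open>K\<close> the group \<open>Homeo\<^sub>K(X)\<close> is second countable and
  regular. Hence every neighbourhood of the identity in \<open>Homeo\<close> of \<open>M\<^sub>0\<close> contains a sequence without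
  cluster point, and every non-discrete \<open>Homeo\<^sub>K(X)\<close> contains a sequence of non-trivial elements
  converging to the identity. Take a countable base \<open>B\<^sub>n\<close> at the identity of \<open>Homeo\<close> of \<open>M\<^sub>0\<close>,
  sequences \<open>x\<^sub>n\<^sub>m\<close> in \<open>B\<^sub>n\<close> without cluster point, and \<open>y\<^sub>n\<^sub>m\<close> converging to the identity
  for \<open>m \<rightarrow> \<infinity>\<close>, supported in compact sets \<open>K\<^sub>n\<close> that form a discrete family away from \<open>M\<^sub>0\<close>.
  If the colimit topology were a group topology, the set of all products \<open>x\<^sub>n\<^sub>m \<circ> y\<^sub>n\<^sub>m\<close> would be
  closed, although it misses the identity and meets \<open>U \<circ> U\<close> for every neighbourhood \<open>U\<close> of the
  identity.

  (iii) implies (iv). A Tietze extension of \<open>t\<^sub>n \<mapsto> n\<close> gives a discrete family of compact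
  metrizable neighbourhoods of the points \<open>t\<^sub>n\<close>, whose union is \<open>A\<close>; metrizability follows from
  Urysohn's metrization theorem.

  (i) implies (ii). In a chart, the radial maps \<open>p \<mapsto> |p|\<^sup>k p\<close> of a small ball form a sequence of
  homeomorphisms near the identity, each of whose pointwise cluster points collapses the open ball to its
  centre, so no cluster point is injective.
\<close>

section \<open>The compact-open topology on homeomorphism groups\<close>

text \<open>One ambient topology on all self-maps of the type. Every \<open>Homeo_top X K\<close> is
  a subspace of it, so an open set of one group extends at once to all the others.\<close>

definition maps_compact_open :: "'a topology \<Rightarrow> ('a \<Rightarrow> 'a) topology" where
  "maps_compact_open X =
     topology_generated_by {{h. h ` C \<subseteq> U} | C U. compactin X C \<and> openin X U}"

lemma Homeo_top_eq_subtopology: "Homeo_top X K = subtopology (maps_compact_open X) (Homeo X K)"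
  by (simp add: Homeo_top_def compact_open_topology_def maps_compact_open_def)

text \<open>A point of a union lies in one of its members, so \<open>mono\<close> absorbs arbitrary
  unions and only finite intersections of subbasic sets remain. Local properties of the compact-open
  topology are thereby checked on subbasic sets alone.\<close>

lemma topology_generated_by_nhds_induct:
  assumes "openin (topology_generated_by \<S>) W" and "h \<in> W"
    and sub: "\<And>S. S \<in> \<S> \<Longrightarrow> h \<in> S \<Longrightarrow> P S"
    and int: "\<And>A B. P A \<Longrightarrow> P B \<Longrightarrow> P (A \<inter> B)"
    and mono: "\<And>A B. P A \<Longrightarrow> A \<subseteq> B \<Longrightarrow> P B"
  shows "P W"
proof -
  have "generate_topology_on \<S> W"
    using assms(1) by (rule openin_topology_generated_by)
  from this \<open>h \<in> W\<close> show ?thesis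
  proof induction
    case (UN K)
    then show ?case by (meson Union_iff Union_upper mono)
  qed (auto intro: sub int)
qed

lemma openin_maps_compact_open:
  "compactin X C \<Longrightarrow> openin X U \<Longrightarrow> openin (maps_compact_open X) {h. h ` C \<subseteq> U}"
  unfolding maps_compact_open_def by (rule topology_generated_by_Basis) blast

lemma maps_compact_open_nhds_induct:
  assumes "openin (maps_compact_open X) W" and "h \<in> W"
    and sub: "\<And>C U. compactin X C \<Longrightarrow> openin X U \<Longrightarrow> h ` C \<subseteq> U \<Longrightarrow> P {g. g ` C \<subseteq> U}"
    and int: "\<And>A B. P A \<Longrightarrow> P B \<Longrightarrow> P (A \<inter> B)"
    and mono: "\<And>A B. P A \<Longrightarrow> A \<subseteq> B \<Longrightarrow> P B"
  shows "P W"
  using assms(1)[unfolded maps_compact_open_def] assms(2)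
  by (rule topology_generated_by_nhds_induct) (use sub int mono in auto)

lemma topspace_maps_compact_open [simp]: "topspace (maps_compact_open X) = UNIV"
proof -
  \<comment> \<open>With the empty compact set the condition is vacuous, so this subbasic set is all
    of \<open>UNIV\<close>.\<close>
  have "openin (maps_compact_open X) {h. h ` {} \<subseteq> {}}"
    by (rule openin_maps_compact_open) auto
  then show ?thesis using openin_subset by fastforce
qed

lemma topspace_Homeo_top [simp]: "topspace (Homeo_top X K) = Homeo X K"
  by (simp add: Homeo_top_eq_subtopology)

lemma openin_Homeo_top:
  "openin (Homeo_top X K) W \<longleftrightarrow> (\<exists>W'. openin (maps_compact_open X) W' \<and> W = W' \<inter> Homeo X K)"
  by (simp add: Homeo_top_eq_subtopology openin_subtopology)

lemma openin_Homeo_top_subbasic: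
  "compactin X C \<Longrightarrow> openin X U \<Longrightarrow> openin (Homeo_top X K) {h \<in> Homeo X K. h ` C \<subseteq> U}"
  unfolding openin_Homeo_top using openin_maps_compact_open by fastforce

lemma Homeo_top_nhds_induct:
  assumes "openin (Homeo_top X K) W" and "h \<in> W"
    and sub: "\<And>C U. compactin X C \<Longrightarrow> openin X U \<Longrightarrow> h ` C \<subseteq> U \<Longrightarrow> P {g \<in> Homeo X K. g ` C \<subseteq> U}"
    and int: "\<And>A B. P A \<Longrightarrow> P B \<Longrightarrow> P (A \<inter> B)"
    and mono: "\<And>A B. P A \<Longrightarrow> A \<subseteq> B \<Longrightarrow> P B"
  shows "P W"
proof -
  obtain W' where W': "openin (maps_compact_open X) W'" "W = W' \<inter> Homeo X K"
    using assms(1) by (auto simp: openin_Homeo_top)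
  have "P (W' \<inter> Homeo X K)"
  proof (rule maps_compact_open_nhds_induct[OF W'(1)])
    show "h \<in> W'" using assms(2) W'(2) by blast
    show "P ({g. g ` C \<subseteq> U} \<inter> Homeo X K)" if "compactin X C" "openin X U" "h ` C \<subseteq> U" for C U
      using sub[OF that] by (rule mono) blast
    show "P (A \<inter> B \<inter> Homeo X K)" if "P (A \<inter> Homeo X K)" "P (B \<inter> Homeo X K)" for A B
      using int[OF that] by (rule mono) blast
    show "P (B \<inter> Homeo X K)" if "P (A \<inter> Homeo X K)" "A \<subseteq> B" for A B
      using that(1) by (rule mono) (use that(2) in blast)
  qed
  then show ?thesis using W' by simp
qed

section \<open>The group structure of \<open>Homeo X K\<close>\<close>

lemma Homeo_mono: "K \<subseteq> L \<Longrightarrow> Homeo X K \<subseteq> Homeo X L"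
  by (auto simp: Homeo_def)

lemma Homeo_top_mono: "K \<subseteq> L \<Longrightarrow> Homeo_top X K = subtopology (Homeo_top X L) (Homeo X K)"
  using Homeo_mono[of K L X]
  by (simp add: Homeo_top_eq_subtopology subtopology_subtopology Int_absorb1)

lemma id_in_Homeo [simp]: "id \<in> Homeo X K"
  by (simp add: Homeo_def homeomorphic_map_id)

lemma Homeo_continuous_map: "h \<in> Homeo X K \<Longrightarrow> continuous_map X X h"
  by (simp add: Homeo_def homeomorphic_imp_continuous_map)

lemma Homeo_fixes: "h \<in> Homeo X K \<Longrightarrow> x \<notin> K \<Longrightarrow> h x = x"
  by (simp add: Homeo_def)

lemma Homeo_comp: "g \<in> Homeo X K \<Longrightarrow> h \<in> Homeo X K \<Longrightarrow> g \<circ> h \<in> Homeo X K"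
  using homeomorphic_map_compose[of X X h X g] by (simp add: Homeo_def)

text \<open>Outside \<open>topspace X\<close> the map is the identity because \<open>K\<close> lies
  inside, so bijectivity on the space extends to the whole type. This makes the total function
  \<open>inv h\<close> a genuine inverse.\<close>

lemma Homeo_bij:
  assumes "h \<in> Homeo X K" "K \<subseteq> topspace X"
  shows "bij h"
proof -
  have b: "bij_betw h (topspace X) (topspace X)"
    using assms(1) unfolding Homeo_def bij_betw_def
    by (metis (no_types, lifting) homeomorphic_eq_everything_map mem_Collect_eq)
  have i: "bij_betw h (- topspace X) (- topspace X)"
  proof -
    have "bij_betw id (- topspace X) (- topspace X)" by simp
    moreover have "h x = id x" if "x \<in> - topspace X" for x
      using that assms Homeo_fixes[of h X K x] by auto
    ultimately show ?thesis using bij_betw_cong[of "- topspace X" h id] by blast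
  qed
  have "bij_betw h (topspace X \<union> - topspace X) (topspace X \<union> - topspace X)"
    using b i by (rule bij_betw_combine) auto
  then show ?thesis by simp
qed

text \<open>A bijection that fixes the complement of \<open>K\<close> pointwise maps this complement
  onto itself, and hence \<open>K\<close> onto itself.\<close>

lemma Homeo_image:
  assumes "h \<in> Homeo X K" "K \<subseteq> topspace X"
  shows "h ` K = K"
proof -
  have b: "bij h" using Homeo_bij[OF assms] .
  have "h ` (- K) = - K"
    using Homeo_fixes[OF assms(1)] by (force simp: image_iff)
  then have "- (h ` K) = - K" using b by (simp add: bij_image_Compl_eq)
  then show ?thesis by simp
qed

lemma Homeo_inv:
  assumes "h \<in> Homeo X K" "K \<subseteq> topspace X"
  shows "inv h \<in> Homeo X K"
proof -
  have b: "bij h" using Homeo_bij[OF assms] .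
  obtain g where g: "homeomorphic_maps X X h g"
    using assms(1) by (auto simp: Homeo_def homeomorphic_map_maps)
  have "inv h y = g y" if "y \<in> topspace X" for y
    using g that b by (metis bij_inv_eq_iff homeomorphic_maps_def)
  then have "homeomorphic_map X X (inv h)"
    using homeomorphic_map_eq[OF homeomorphic_maps_imp_map[OF iffD1[OF homeomorphic_maps_sym g]]]
    by metis
  moreover have "inv h x = x" if "x \<notin> K" for x
    using b Homeo_fixes[OF assms(1) that] by (metis bij_inv_eq_iff)
  ultimately show ?thesis by (simp add: Homeo_def)
qed

section \<open>Left translations and homogeneity\<close>

lemma continuous_map_Homeo_left_translation:
  assumes g: "g \<in> Homeo X K"
  shows "continuous_map (Homeo_top X K) (Homeo_top X K) (\<lambda>h. g \<circ> h)"
  unfolding continuous_map_def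
proof (intro conjI allI impI)
  show "(\<circ>) g \<in> topspace (Homeo_top X K) \<rightarrow> topspace (Homeo_top X K)"
    using g by (auto intro: Homeo_comp)
  fix W assume W: "openin (Homeo_top X K) W"
  show "openin (Homeo_top X K) {h \<in> topspace (Homeo_top X K). g \<circ> h \<in> W}"
  proof (subst openin_subopen, intro ballI)
    fix h assume h: "h \<in> {h \<in> topspace (Homeo_top X K). g \<circ> h \<in> W}"
    show "\<exists>T. openin (Homeo_top X K) T \<and> h \<in> T \<and> T \<subseteq> {h \<in> topspace (Homeo_top X K). g \<circ> h \<in> W}"
    proof (rule Homeo_top_nhds_induct[OF W, of "g \<circ> h"])
      fix C U assume CU: "compactin X C" "openin X U" "(g \<circ> h) ` C \<subseteq> U"
      \<comment> \<open>\<open>g \<circ> h\<close> sends \<open>C\<close> into \<open>U\<close>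
        exactly when \<open>h\<close> sends \<open>C\<close> into the preimage of \<open>U\<close>
        under \<open>g\<close>, so subbasic sets pull back to subbasic sets.\<close>
      let ?V = "{x \<in> topspace X. g x \<in> U}"
      have V: "openin X ?V"
        using Homeo_continuous_map[OF g] CU(2) openin_continuous_map_preimage by fastforce
      have "compactin X (h ` C)"
        using h CU(1) Homeo_continuous_map[of h X K] image_compactin by fastforce
      then have "h ` C \<subseteq> ?V"
        using CU(3) compactin_subset_topspace by fastforce
      then show "\<exists>T. openin (Homeo_top X K) T \<and> h \<in> T
            \<and> T \<subseteq> {h \<in> topspace (Homeo_top X K). g \<circ> h \<in> {g \<in> Homeo X K. g ` C \<subseteq> U}}"
        using openin_Homeo_top_subbasic[OF CU(1) V, of K] h g
        by (intro exI[of _ "{f \<in> Homeo X K. f ` C \<subseteq> ?V}"]) (auto intro: Homeo_comp)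
    next
      fix A B
      assume "\<exists>T. openin (Homeo_top X K) T \<and> h \<in> T \<and> T \<subseteq> {h \<in> topspace (Homeo_top X K). g \<circ> h \<in> A}"
        and "\<exists>T. openin (Homeo_top X K) T \<and> h \<in> T \<and> T \<subseteq> {h \<in> topspace (Homeo_top X K). g \<circ> h \<in> B}"
      then obtain S T where "openin (Homeo_top X K) S" "h \<in> S" "S \<subseteq> {h \<in> topspace (Homeo_top X K). g \<circ> h \<in> A}"
        "openin (Homeo_top X K) T" "h \<in> T" "T \<subseteq> {h \<in> topspace (Homeo_top X K). g \<circ> h \<in> B}"
        by blast
      then show "\<exists>T. openin (Homeo_top X K) T \<and> h \<in> T \<and> T \<subseteq> {h \<in> topspace (Homeo_top X K). g \<circ> h \<in> A \<inter> B}"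
        by (intro exI[of _ "S \<inter> T"]) auto
    qed (use h in blast)+
  qed
qed

lemma homeomorphic_map_Homeo_left_translation:
  assumes g: "g \<in> Homeo X K" and K: "K \<subseteq> topspace X"
  shows "homeomorphic_map (Homeo_top X K) (Homeo_top X K) (\<lambda>h. g \<circ> h)"
proof -
  have b: "bij g" using Homeo_bij[OF assms] .
  have "inv g \<circ> (g \<circ> h) = h" "g \<circ> (inv g \<circ> h) = h" for h
    using b by (auto simp: fun_eq_iff bij_is_inj bij_is_surj surj_f_inv_f)
  then have "homeomorphic_maps (Homeo_top X K) (Homeo_top X K) (\<lambda>h. g \<circ> h) (\<lambda>h. inv g \<circ> h)"
    unfolding homeomorphic_maps_def
    by (intro conjI continuous_map_Homeo_left_translation Homeo_inv assms) auto
  then show ?thesis by (rule homeomorphic_maps_imp_map)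
qed

text \<open>Left translations are homeomorphisms and carry an isolated identity to every element.
  Used contrapositively: in a non-discrete group there are non-trivial elements arbitrarily near the
  identity.\<close>

lemma Homeo_top_discrete_if_id_isolated:
  assumes "openin (Homeo_top X K) {id}" and K: "K \<subseteq> topspace X"
  shows "Homeo_top X K = discrete_topology (Homeo X K)"
proof -
  have "openin (Homeo_top X K) {g}" if "g \<in> Homeo X K" for g
  proof -
    have "openin (Homeo_top X K) ((\<lambda>h. g \<circ> h) ` {id})"
      using homeomorphic_map_Homeo_left_translation[OF that K] assms(1)
      by (meson homeomorphic_imp_open_map open_map_def)
    then show ?thesis by simp
  qed
  then show ?thesis
    by (metis discrete_topology_unique topspace_Homeo_top)
qed

text \<open>A compact neighbourhood of the identity translates to every element. Used
  contrapositively: without local compactness, no neighbourhood of the identity is compact.\<close>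

lemma Homeo_top_locally_compact_if_at_id:
  assumes U: "openin (Homeo_top X K) U" "id \<in> U" "U \<subseteq> N" "compactin (Homeo_top X K) N"
    and K: "K \<subseteq> topspace X"
  shows "locally_compact_space (Homeo_top X K)"
  unfolding locally_compact_space_def
proof
  fix g assume "g \<in> topspace (Homeo_top X K)"
  then have g: "homeomorphic_map (Homeo_top X K) (Homeo_top X K) (\<lambda>h. g \<circ> h)"
    using homeomorphic_map_Homeo_left_translation K by auto
  have "openin (Homeo_top X K) ((\<lambda>h. g \<circ> h) ` U)"
    using g U(1) by (meson homeomorphic_imp_open_map open_map_def)
  moreover have "compactin (Homeo_top X K) ((\<lambda>h. g \<circ> h) ` N)"
    using g U(4) by (meson homeomorphic_imp_continuous_map image_compactin)
  moreover have "g \<in> (\<lambda>h. g \<circ> h) ` U" using U(2) by (metis comp_id image_eqI)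
  ultimately show "\<exists>U L. openin (Homeo_top X K) U \<and> compactin (Homeo_top X K) L \<and> g \<in> U \<and> U \<subseteq> L"
    using U(3) by blast
qed

text \<open>Regularity of \<open>X\<close> separates the compact image of \<open>C\<close> from the
  complement of \<open>U\<close> by disjoint open sets \<open>V\<close> and \<open>V'\<close>. The
  maps sending \<open>C\<close> off \<open>V'\<close> form a closed set that lies between the
  subbasic neighbourhoods given by \<open>V\<close> and by \<open>U\<close>.\<close>

lemma regular_Homeo_top:
  assumes "locally_compact_space X" "Hausdorff_space X"
  shows "regular_space (Homeo_top X K)"
  unfolding neighbourhood_base_of_closedin[symmetric] neighbourhood_base_of
proof (intro allI impI)
  fix W h assume W: "openin (Homeo_top X K) W \<and> h \<in> W"
  then have h: "h \<in> Homeo X K" using openin_subset by fastforce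
  show "\<exists>U V. openin (Homeo_top X K) U \<and> closedin (Homeo_top X K) V \<and> h \<in> U \<and> U \<subseteq> V \<and> V \<subseteq> W"
  proof (rule Homeo_top_nhds_induct[of X K W h])
    fix C U assume CU: "compactin X C" "openin X U" "h ` C \<subseteq> U"
    have hC: "compactin X (h ` C)"
      using h CU(1) Homeo_continuous_map image_compactin by blast
    have "regular_space X"
      using assms locally_compact_Hausdorff_imp_regular_space by blast
    moreover have "compactin X (h ` C) \<and> closedin X (topspace X - U) \<and> disjnt (h ` C) (topspace X - U)"
      using hC CU by (auto simp: disjnt_iff)
    ultimately obtain V V' where V: "openin X V" "openin X V'" "h ` C \<subseteq> V" "topspace X - U \<subseteq> V'" "disjnt V V'"
      using regular_space_compact_closed_sets by metis
    let ?N = "{g \<in> Homeo X K. g ` C \<subseteq> topspace X - V'}"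
    \<comment> \<open>Leaving \<open>?N\<close> means sending some single point of \<open>C\<close>
      into \<open>V'\<close>, so the complement is a union of subbasic sets for one-point compact
      sets.\<close>
    have "Homeo X K - ?N = (\<Union>c\<in>C. {g \<in> Homeo X K. g ` {c} \<subseteq> V'})"
    proof -
      have "g c \<in> topspace X" if "g \<in> Homeo X K" "c \<in> C" for g c
        using Homeo_continuous_map[OF that(1)] compactin_subset_topspace[OF CU(1)] that(2)
        by (auto simp: continuous_map_def)
      then show ?thesis by blast
    qed
    moreover have "openin (Homeo_top X K) (\<Union>c\<in>C. {g \<in> Homeo X K. g ` {c} \<subseteq> V'})"
    proof (rule openin_Union, clarify)
      fix c assume "c \<in> C"
      then have "compactin X {c}" using compactin_subset_topspace[OF CU(1)] by auto
      then show "openin (Homeo_top X K) {g \<in> Homeo X K. g ` {c} \<subseteq> V'}"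
        using V(2) by (rule openin_Homeo_top_subbasic)
    qed
    ultimately have "closedin (Homeo_top X K) ?N"
      by (auto simp: closedin_def)
    moreover have "openin (Homeo_top X K) {g \<in> Homeo X K. g ` C \<subseteq> V}"
      using CU(1) V(1) by (rule openin_Homeo_top_subbasic)
    moreover have "V \<subseteq> topspace X - V'"
      using V(5) openin_subset[OF V(1)] by (auto simp: disjnt_iff)
    moreover have "?N \<subseteq> {g \<in> Homeo X K. g ` C \<subseteq> U}"
      using V(4) by auto
    moreover have "h \<in> {g \<in> Homeo X K. g ` C \<subseteq> V}"
      using h V(3) by auto
    moreover have "{g \<in> Homeo X K. g ` C \<subseteq> V} \<subseteq> ?N"
      using \<open>V \<subseteq> topspace X - V'\<close> by auto
    ultimately show "\<exists>S N. openin (Homeo_top X K) S \<and> closedin (Homeo_top X K) N \<and> h \<in> S \<and> S \<subseteq> N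
         \<and> N \<subseteq> {g \<in> Homeo X K. g ` C \<subseteq> U}"
      by (intro exI conjI)
  next
    fix A B
    assume "\<exists>U V. openin (Homeo_top X K) U \<and> closedin (Homeo_top X K) V \<and> h \<in> U \<and> U \<subseteq> V \<and> V \<subseteq> A"
      and "\<exists>U V. openin (Homeo_top X K) U \<and> closedin (Homeo_top X K) V \<and> h \<in> U \<and> U \<subseteq> V \<and> V \<subseteq> B"
    then obtain U V U' V' where "openin (Homeo_top X K) U" "closedin (Homeo_top X K) V" "h \<in> U" "U \<subseteq> V" "V \<subseteq> A"
      "openin (Homeo_top X K) U'" "closedin (Homeo_top X K) V'" "h \<in> U'" "U' \<subseteq> V'" "V' \<subseteq> B"
      by blast
    then show "\<exists>U V. openin (Homeo_top X K) U \<and> closedin (Homeo_top X K) V \<and> h \<in> U \<and> U \<subseteq> V \<and> V \<subseteq> A \<inter> B"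
      by (intro exI[of _ "U \<inter> U'"] exI[of _ "V \<inter> V'"]) auto
  qed (use W in blast)+
qed

section \<open>Second countability of the homeomorphism groups\<close>

lemma compact_metrizable_imp_second_countable:
  assumes "compact_space Y" "metrizable_space Y"
  shows "second_countable Y"
proof -
  obtain M d where "Metric_space M d" and Y: "Y = Metric_space.mtopology M d"
    using assms(2) by (auto simp: metrizable_space_def)
  then interpret Metric_space M d by simp
  have "compactin mtopology M"
    using assms(1) Y by (simp add: compact_space_def)
  \<comment> \<open>Finite nets of mesh 1/(n+1), one for each n, give countably many balls; these
    form the base.\<close>
  then have "mtotally_bounded M" by (rule compactin_imp_mtotally_bounded)
  then have "\<forall>n::nat. \<exists>F. finite F \<and> F \<subseteq> M \<and> M \<subseteq> (\<Union>x\<in>F. mball x (inverse (real (Suc n))))"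
    unfolding mtotally_bounded_def by (metis inverse_positive_iff_positive of_nat_0_less_iff zero_less_Suc)
  then obtain F where F: "\<And>n::nat. finite (F n)" "\<And>n. F n \<subseteq> M"
    "\<And>n. M \<subseteq> (\<Union>x\<in>F n. mball x (inverse (real (Suc n))))"
    by metis
  define \<B> where "\<B> = (\<Union>n. (\<lambda>x. mball x (inverse (real (Suc n)))) ` F n)"
  have "countable \<B>"
    unfolding \<B>_def by (intro countable_UN countable_image) (auto intro: countable_finite F(1))
  moreover have "\<forall>V\<in>\<B>. openin mtopology V"
    unfolding \<B>_def by auto
  moreover have "\<exists>V\<in>\<B>. x \<in> V \<and> V \<subseteq> U" if U: "openin mtopology U" "x \<in> U" for U x
  proof -
    obtain e where e: "e > 0" "mball x e \<subseteq> U"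
      using U unfolding openin_mtopology by blast
    have xM: "x \<in> M" using that unfolding openin_mtopology by blast
    \<comment> \<open>Half of \<open>e\<close> is needed because a net point is within this radius
      of \<open>x\<close> and the ball around it has the same radius.\<close>
    obtain n where n: "inverse (real (Suc n)) < e / 2"
      using e(1) reals_Archimedean[of "e / 2"] by auto
    obtain k where k: "k \<in> F n" "x \<in> mball k (inverse (real (Suc n)))"
      using F(3) xM by blast
    have "mball k (inverse (real (Suc n))) \<subseteq> mball x e"
    proof
      fix y assume y: "y \<in> mball k (inverse (real (Suc n)))"
      have "d x y \<le> d x k + d k y" using triangle k y xM by (simp add: in_mball)
      also have "\<dots> < e" using k(2) y n commute[of x k] by (simp add: in_mball)
      finally show "y \<in> mball x e" using y xM by (simp add: in_mball)
    qed
    then show ?thesis using k e(2) unfolding \<B>_def by blast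
  qed
  ultimately show ?thesis unfolding second_countable_def Y by blast
qed

lemma second_countable_if_countable_subbase:
  assumes "countable \<S>" and op: "\<And>S. S \<in> \<S> \<Longrightarrow> openin Y S"
    and nb: "\<And>W h. openin Y W \<Longrightarrow> h \<in> W \<Longrightarrow>
               \<exists>\<F>. finite \<F> \<and> \<F> \<subseteq> \<S> \<and> h \<in> \<Inter>\<F> \<and> \<Inter>\<F> \<inter> topspace Y \<subseteq> W"
  shows "second_countable Y"
  unfolding second_countable_def
proof (intro exI conjI allI impI ballI)
  \<comment> \<open>Intersecting with \<open>topspace Y\<close> gives the right meaning to the empty
    family, whose intersection would otherwise be \<open>UNIV\<close>.\<close>
  let ?B = "(\<lambda>\<F>. topspace Y \<inter> \<Inter>\<F>) ` {\<F>. finite \<F> \<and> \<F> \<subseteq> \<S>}"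
  show "countable ?B"
    using countable_Collect_finite_subset[OF assms(1)] by (rule countable_image)
  show "openin Y V" if V: "V \<in> ?B" for V
  proof -
    obtain \<F> where \<F>: "V = topspace Y \<inter> \<Inter>\<F>" "finite \<F>" "\<F> \<subseteq> \<S>" using V by auto
    have "openin Y (topspace Y \<inter> \<Inter>\<F>)"
      using \<F>(2,3)
    proof (induction \<F> rule: finite_induct)
      case (insert S \<F>)
      have "topspace Y \<inter> \<Inter>(insert S \<F>) = S \<inter> (topspace Y \<inter> \<Inter>\<F>)" by auto
      then show ?case using insert op by (metis insert_subset openin_Int)
    qed auto
    then show ?thesis using \<F>(1) by simp
  qed
  show "\<exists>V\<in>?B. x \<in> V \<and> V \<subseteq> U" if U: "openin Y U \<and> x \<in> U" for U x
  proof -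
    obtain \<F> where \<F>: "finite \<F>" "\<F> \<subseteq> \<S>" "x \<in> \<Inter>\<F>" "\<Inter>\<F> \<inter> topspace Y \<subseteq> U"
      using nb U by meson
    have "x \<in> topspace Y" using U openin_subset by blast
    then have "topspace Y \<inter> \<Inter>\<F> \<in> ?B" "x \<in> topspace Y \<inter> \<Inter>\<F>" "topspace Y \<inter> \<Inter>\<F> \<subseteq> U"
      using \<F> by auto
    then show ?thesis by (intro bexI conjI)
  qed
qed

text \<open>All members agree outside \<open>K\<close>, so only the behaviour on the compact
  metrizable set \<open>K\<close> matters. A countable base of \<open>K\<close> yields a countable
  subbase: the maps sending the closure of one basic set into another.\<close>

lemma second_countable_Homeo_top:
  assumes T2: "Hausdorff_space X" and K: "compactin X K" and met: "metrizable_space (subtopology X K)"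
  shows "second_countable (Homeo_top X K)"
proof -
  define Y where "Y = subtopology X K"
  have Kt: "K \<subseteq> topspace X" using K by (rule compactin_subset_topspace)
  have tY: "topspace Y = K" using Kt by (auto simp: Y_def)
  have cY: "compact_space Y" using K by (simp add: Y_def compact_space_subtopology)
  have rY: "regular_space Y" using met by (simp add: Y_def metrizable_imp_regular_space)
  have Kc: "closedin X K" using K T2 by (simp add: compactin_imp_closedin)
  have "second_countable Y"
    using compact_metrizable_imp_second_countable cY met Y_def by blast
  then obtain \<B> where \<B>: "countable \<B>" "\<And>V. V \<in> \<B> \<Longrightarrow> openin Y V"
    "\<And>U x. openin Y U \<Longrightarrow> x \<in> U \<Longrightarrow> \<exists>V\<in>\<B>. x \<in> V \<and> V \<subseteq> U"
    unfolding second_countable_def by metis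
  define S where "S = (\<lambda>(B, B'). {h \<in> Homeo X K. h ` (Y closure_of B) \<subseteq> B'})"
  show ?thesis
  proof (rule second_countable_if_countable_subbase)
    show "countable (S ` (\<B> \<times> \<B>))" using \<B>(1) by simp
  next
    fix s assume "s \<in> S ` (\<B> \<times> \<B>)"
    then obtain B B' where B: "B \<in> \<B>" "B' \<in> \<B>" "s = {h \<in> Homeo X K. h ` (Y closure_of B) \<subseteq> B'}"
      by (auto simp: S_def)
    obtain U where U: "openin X U" "B' = U \<inter> K"
      using \<B>(2)[OF B(2)] by (auto simp: Y_def openin_subtopology)
    have clK: "Y closure_of B \<subseteq> K" using closure_of_subset_topspace tY by metis
    have "compactin Y (Y closure_of B)"
      using cY by (simp add: closedin_compact_space)
    then have "compactin X (Y closure_of B)"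
      by (simp add: Y_def compactin_subtopology)
    then have "openin (Homeo_top X K) {h \<in> Homeo X K. h ` (Y closure_of B) \<subseteq> U}"
      using U(1) by (rule openin_Homeo_top_subbasic)
    \<comment> \<open>Members map \<open>K\<close> onto itself, so for subsets of \<open>K\<close>
      landing in \<open>U\<close> is the same as landing in its trace \<open>B'\<close>.\<close>
    moreover have "{h \<in> Homeo X K. h ` (Y closure_of B) \<subseteq> U} = s"
      unfolding B(3) U(2) using Homeo_image[OF _ Kt] clK by blast
    ultimately show "openin (Homeo_top X K) s" by simp
  next
    fix W h assume W: "openin (Homeo_top X K) W" "h \<in> W"
    then have h: "h \<in> Homeo X K" using openin_subset by fastforce
    show "\<exists>\<F>. finite \<F> \<and> \<F> \<subseteq> S ` (\<B> \<times> \<B>) \<and> h \<in> \<Inter>\<F> \<and> \<Inter>\<F> \<inter> topspace (Homeo_top X K) \<subseteq> W"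
    proof (rule Homeo_top_nhds_induct[OF W])
      fix C U assume CU: "compactin X C" "openin X U" "h ` C \<subseteq> U"
      have CK: "compactin Y (C \<inter> K)"
        using CU(1) Kc by (simp add: Y_def compactin_subtopology compact_Int_closedin)
      \<comment> \<open>Around each point of \<open>C \<inter> K\<close>, regularity of
        \<open>K\<close> provides a basic set whose closure is still mapped into a basic subset of
        \<open>U\<close>. Finitely many of these sets then cover
        \<open>C \<inter> K\<close>.\<close>
      have "\<exists>B\<in>\<B>. \<exists>B'\<in>\<B>. x \<in> B \<and> h ` (Y closure_of B) \<subseteq> B' \<and> B' \<subseteq> U" if x: "x \<in> C \<inter> K" for x
      proof -
        have "openin Y (U \<inter> K)" using CU(2) by (auto simp: Y_def openin_subtopology)
        moreover have "h x \<in> U \<inter> K" using x CU(3) Homeo_image[OF h Kt] by blast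
        ultimately obtain B' where B': "B' \<in> \<B>" "h x \<in> B'" "B' \<subseteq> U \<inter> K"
          using \<B>(3) by blast
        obtain U' where U': "openin X U'" "B' = U' \<inter> K"
          using \<B>(2)[OF B'(1)] by (auto simp: Y_def openin_subtopology)
        have "openin X {y \<in> topspace X. h y \<in> U'}"
          using Homeo_continuous_map[OF h] U'(1) openin_continuous_map_preimage by fastforce
        then have "openin Y ({y \<in> topspace X. h y \<in> U'} \<inter> K)"
          by (auto simp: Y_def openin_subtopology)
        moreover have "x \<in> {y \<in> topspace X. h y \<in> U'} \<inter> K" using x B'(2) U'(2) Kt by blast
        ultimately obtain O1 C1 where O1: "openin Y O1" "closedin Y C1" "x \<in> O1" "O1 \<subseteq> C1"
          "C1 \<subseteq> {y \<in> topspace X. h y \<in> U'} \<inter> K"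
          using rY unfolding neighbourhood_base_of_closedin[symmetric] neighbourhood_base_of by meson
        obtain B where B: "B \<in> \<B>" "x \<in> B" "B \<subseteq> O1" using \<B>(3) O1 by blast
        have "Y closure_of B \<subseteq> C1" using B(3) O1 by (meson closure_of_minimal subset_trans)
        then have "h ` (Y closure_of B) \<subseteq> B'"
          using O1(5) U'(2) Homeo_image[OF h Kt] by blast
        moreover have "B' \<subseteq> U" using B'(3) by blast
        ultimately show ?thesis using B(1,2) B'(1) by (intro bexI[of _ B] bexI[of _ B'] conjI)
      qed
      then obtain b b' where b: "\<And>x. x \<in> C \<inter> K \<Longrightarrow> b x \<in> \<B> \<and> b' x \<in> \<B> \<and> x \<in> b x \<and>
          h ` (Y closure_of b x) \<subseteq> b' x \<and> b' x \<subseteq> U"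
        by metis
      have "\<exists>\<U>. finite \<U> \<and> \<U> \<subseteq> b ` (C \<inter> K) \<and> C \<inter> K \<subseteq> \<Union>\<U>"
        by (rule compactinD[OF CK]) (use b \<B>(2) in auto)
      then obtain F where F: "finite F" "F \<subseteq> C \<inter> K" "C \<inter> K \<subseteq> \<Union>(b ` F)"
        by (metis finite_subset_image)
      let ?F = "(\<lambda>x. S (b x, b' x)) ` F"
      have "h \<in> \<Inter>?F" using F(2) b h by (auto simp: S_def subset_iff)
      moreover have "?F \<subseteq> S ` (\<B> \<times> \<B>)" using F(2) b by blast
      moreover have "\<Inter>?F \<inter> topspace (Homeo_top X K) \<subseteq> {g \<in> Homeo X K. g ` C \<subseteq> U}"
      proof clarsimp
        fix g c assume g: "\<forall>x\<in>F. g \<in> S (b x, b' x)" "g \<in> Homeo X K" and c: "c \<in> C"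
        show "g c \<in> U"
        proof (cases "c \<in> K")
          case True
          then obtain x where x: "x \<in> F" "c \<in> b x" using F(3) c by blast
          then have bx: "b x \<in> \<B>" "b' x \<subseteq> U" using b F(2) by auto
          have "c \<in> Y closure_of b x"
            using x(2) closure_of_subset[OF openin_subset[OF \<B>(2)[OF bx(1)]]] by blast
          then have "g c \<in> b' x" using g(1) x(1) by (auto simp: S_def)
          then show ?thesis using bx by blast
        next
          case False
          \<comment> \<open>Points of \<open>C\<close> outside \<open>K\<close> impose no condition:
            both maps fix them, and \<open>h\<close> already sends \<open>C\<close> into
            \<open>U\<close>.\<close>
          then have "g c = h c" using g(2) h Homeo_fixes by metis
          then show ?thesis using CU(3) c by auto
        qed
      qed
      ultimately show "\<exists>\<F>. finite \<F> \<and> \<F> \<subseteq> S ` (\<B> \<times> \<B>) \<and> h \<in> \<Inter>\<F> \<and>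
           \<Inter>\<F> \<inter> topspace (Homeo_top X K) \<subseteq> {g \<in> Homeo X K. g ` C \<subseteq> U}"
        using F(1) by (intro exI[of _ ?F]) simp
    next
      fix A B
      assume "\<exists>\<F>. finite \<F> \<and> \<F> \<subseteq> S ` (\<B> \<times> \<B>) \<and> h \<in> \<Inter>\<F> \<and> \<Inter>\<F> \<inter> topspace (Homeo_top X K) \<subseteq> A"
        and "\<exists>\<F>. finite \<F> \<and> \<F> \<subseteq> S ` (\<B> \<times> \<B>) \<and> h \<in> \<Inter>\<F> \<and> \<Inter>\<F> \<inter> topspace (Homeo_top X K) \<subseteq> B"
      then obtain \<F> \<G> where "finite \<F>" "\<F> \<subseteq> S ` (\<B> \<times> \<B>)" "h \<in> \<Inter>\<F>" "\<Inter>\<F> \<inter> topspace (Homeo_top X K) \<subseteq> A"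
        "finite \<G>" "\<G> \<subseteq> S ` (\<B> \<times> \<B>)" "h \<in> \<Inter>\<G>" "\<Inter>\<G> \<inter> topspace (Homeo_top X K) \<subseteq> B"
        by metis
      then show "\<exists>\<F>. finite \<F> \<and> \<F> \<subseteq> S ` (\<B> \<times> \<B>) \<and> h \<in> \<Inter>\<F> \<and> \<Inter>\<F> \<inter> topspace (Homeo_top X K) \<subseteq> A \<inter> B"
        by (intro exI[of _ "\<F> \<union> \<G>"]) auto
    qed (meson subset_trans)
  qed
qed

section \<open>Sequences without cluster point and sequences tending to the identity\<close>

lemma noncompact_closed_sequence:
  assumes "second_countable Y" "closedin Y N" "\<not> compactin Y N"
  obtains x :: "nat \<Rightarrow> 'b" where "range x \<subseteq> N"
    "\<And>z. z \<in> topspace Y \<Longrightarrow> \<exists>U. openin Y U \<and> z \<in> U \<and> finite {m. x m \<in> U}"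
proof -
  have Nt: "N \<subseteq> topspace Y" using assms(2) by (rule closedin_subset)
  then have tN: "topspace (subtopology Y N) = N" by auto
  have "Lindelof_space (subtopology Y N)"
    using assms(1) second_countable_subtopology second_countable_imp_Lindelof_space by blast
  moreover have "\<not> compact_space (subtopology Y N)"
    using assms(3) Nt by (simp add: compact_space_subtopology compactin_subspace)
  then have "\<exists>\<U>. ((\<forall>U\<in>\<U>. openin (subtopology Y N) U) \<and> N \<subseteq> \<Union>\<U>)
      \<and> (\<forall>\<F>. finite \<F> \<longrightarrow> \<F> \<subseteq> \<U> \<longrightarrow> \<not> N \<subseteq> \<Union>\<F>)"
    unfolding compact_space_alt tN by (simp, metis)
  then obtain \<U> where \<U>: "\<forall>U\<in>\<U>. openin (subtopology Y N) U" "N \<subseteq> \<Union>\<U>"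
    "\<And>\<F>. finite \<F> \<Longrightarrow> \<F> \<subseteq> \<U> \<Longrightarrow> \<not> N \<subseteq> \<Union>\<F>"
    by metis
  ultimately obtain \<V> where \<V>: "countable \<V>" "\<V> \<subseteq> \<U>" "N \<subseteq> \<Union>\<V>"
    unfolding Lindelof_space_alt tN by metis
  have ne: "\<V> \<noteq> {}" using \<V> \<U>(3)[of "{}"] by auto
  define V where "V = from_nat_into \<V>"
  have rV: "range V = \<V>" using ne \<V>(1) by (simp add: V_def range_from_nat_into)
  \<comment> \<open>\<open>V\<close> enumerates a countable cover of \<open>N\<close> without finite
    subcover, so \<open>x m\<close> can be chosen outside the first m+1 members. Each member then
    contains terms for finitely many indices only.\<close>
  have "\<not> N \<subseteq> \<Union>(V ` {..m})" for m
    using \<V>(2) rV by (intro \<U>(3)) auto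
  then have "\<exists>y. y \<in> N \<and> y \<notin> \<Union>(V ` {..m})" for m
    by blast
  then obtain x where x: "\<And>m. x m \<in> N" "\<And>m. x m \<notin> \<Union>(V ` {..m})" by metis
  show ?thesis
  proof
    show "range x \<subseteq> N" using x by auto
    fix z assume z: "z \<in> topspace Y"
    show "\<exists>U. openin Y U \<and> z \<in> U \<and> finite {m. x m \<in> U}"
    proof (cases "z \<in> N")
      case True
      then obtain i where i: "z \<in> V i" using \<V>(3) rV by auto
      have "openin (subtopology Y N) (V i)" using \<U>(1) \<V>(2) rV by auto
      then obtain U where U: "openin Y U" "V i = U \<inter> N" by (auto simp: openin_subtopology)
      have "{m. x m \<in> U} \<subseteq> {..<i}"
      proof
        fix m assume "m \<in> {m. x m \<in> U}"
        then have "x m \<in> V i" using U(2) x(1) by auto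
        then show "m \<in> {..<i}" using x(2)[of m] by (metis UN_I atMost_iff lessThan_iff not_less)
      qed
      then show ?thesis using U i finite_subset by blast
    next
      case False
      then show ?thesis using z assms(2) x(1)
        by (intro exI[of _ "topspace Y - N"]) auto
    qed
  qed
qed

lemma decreasing_neighbourhood_base:
  assumes "first_countable Y" "z \<in> topspace Y"
  shows "\<exists>B :: nat \<Rightarrow> 'b set. (\<forall>n. openin Y (B n) \<and> z \<in> B n) \<and> (\<forall>m n. m \<le> n \<longrightarrow> B n \<subseteq> B m)
           \<and> (\<forall>W. openin Y W \<and> z \<in> W \<longrightarrow> (\<exists>n. B n \<subseteq> W))"
proof -
  obtain \<B> where \<B>: "countable \<B>" "\<And>V. V \<in> \<B> \<Longrightarrow> openin Y V"
    "\<And>U. openin Y U \<Longrightarrow> z \<in> U \<Longrightarrow> \<exists>V\<in>\<B>. z \<in> V \<and> V \<subseteq> U"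
    using assms unfolding first_countable_def by metis
  define \<C> where "\<C> = {V \<in> \<B>. z \<in> V}"
  have \<C>: "countable \<C>" "\<C> \<noteq> {}"
    using \<B>(1) \<B>(3)[OF openin_topspace assms(2)] by (auto simp: \<C>_def)
  define V where "V = from_nat_into \<C>"
  have V: "V n \<in> \<C>" for n using \<C> by (simp add: V_def from_nat_into)
  \<comment> \<open>Initial intersections make the base nested, so that choosing one element in each
    \<open>B n\<close> gives a sequence converging to \<open>z\<close>.\<close>
  define B where "B n = \<Inter>(V ` {..n})" for n
  show ?thesis
  proof (intro exI[of _ B] conjI allI impI)
    show "openin Y (B n)" for n
      unfolding B_def using V \<B>(2) by (intro openin_Inter) (auto simp: \<C>_def)
    show "z \<in> B n" for n unfolding B_def using V by (auto simp: \<C>_def)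
    show "B n \<subseteq> B m" if "m \<le> n" for m n unfolding B_def using that by force
    fix W assume "openin Y W \<and> z \<in> W"
    then obtain U where U: "U \<in> \<C>" "U \<subseteq> W" using \<B>(3) by (auto simp: \<C>_def)
    then obtain n where "V n = U" using \<C> by (metis V_def from_nat_into_surj)
    then show "\<exists>n. B n \<subseteq> W" using U(2) by (intro exI[of _ n]) (auto simp: B_def)
  qed
qed

text \<open>Regularity puts a closed neighbourhood \<open>N\<close> of the identity inside
  \<open>W\<close>. It cannot be compact, since translation would make the whole group locally
  compact, and a closed non-compact set in a second countable space contains such a
  sequence.\<close>

lemma Homeo_sequence_without_cluster_point:
  assumes X: "locally_compact_space X" "Hausdorff_space X"
    and K: "compactin X K" "metrizable_space (subtopology X K)"
    and nlc: "\<not> locally_compact_space (Homeo_top X K)"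
    and W: "openin (Homeo_top X K) W" "id \<in> W"
  obtains x :: "nat \<Rightarrow> 'a \<Rightarrow> 'a" where "range x \<subseteq> W"
    "\<And>z. z \<in> Homeo X K \<Longrightarrow> \<exists>U. openin (Homeo_top X K) U \<and> z \<in> U \<and> finite {m. x m \<in> U}"
proof -
  obtain U N where U: "openin (Homeo_top X K) U" "closedin (Homeo_top X K) N" "id \<in> U" "U \<subseteq> N" "N \<subseteq> W"
    using regular_Homeo_top[OF X, of K] W
    unfolding neighbourhood_base_of_closedin[symmetric] neighbourhood_base_of by meson
  have "\<not> compactin (Homeo_top X K) N"
    using Homeo_top_locally_compact_if_at_id[OF U(1,3,4)] nlc compactin_subset_topspace[OF K(1)] by blast
  then show ?thesis
    using noncompact_closed_sequence[OF second_countable_Homeo_top[OF X(2) K] U(2)] U(5) that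
    by (metis subset_trans topspace_Homeo_top)
qed

text \<open>The identity is not isolated, so every set of a nested countable base at the identity
  contains another map.\<close>

lemma Homeo_sequence_tendsto_id:
  assumes X: "Hausdorff_space X"
    and K: "compactin X K" "metrizable_space (subtopology X K)"
    and nd: "Homeo_top X K \<noteq> discrete_topology (Homeo X K)"
  obtains y :: "nat \<Rightarrow> 'a \<Rightarrow> 'a" where "\<And>m. y m \<in> Homeo X K" "\<And>m. y m \<noteq> id"
    "\<And>W. openin (Homeo_top X K) W \<Longrightarrow> id \<in> W \<Longrightarrow> \<exists>M. \<forall>m\<ge>M. y m \<in> W"
proof -
  have "first_countable (Homeo_top X K)"
    using second_countable_Homeo_top[OF X K] by (rule second_countable_imp_first_countable)
  moreover have "id \<in> topspace (Homeo_top X K)" by simp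
  ultimately obtain B :: "nat \<Rightarrow> ('a \<Rightarrow> 'a) set" where base: "\<forall>n. openin (Homeo_top X K) (B n) \<and> id \<in> B n"
    "\<forall>m n. m \<le> n \<longrightarrow> B n \<subseteq> B m"
    "\<forall>W. openin (Homeo_top X K) W \<and> id \<in> W \<longrightarrow> (\<exists>n. B n \<subseteq> W)"
    using decreasing_neighbourhood_base by metis
  then have B: "\<And>n. openin (Homeo_top X K) (B n)" "\<And>n. id \<in> B n"
    by auto
  have "\<exists>g. g \<in> B n \<and> g \<noteq> id" for n
  proof (rule ccontr)
    assume "\<not> ?thesis"
    then have "B n = {id}" using B(2) by blast
    then show False
      using Homeo_top_discrete_if_id_isolated[of X K] B(1)[of n] nd compactin_subset_topspace[OF K(1)] by simp
  qed
  then obtain y where y: "\<And>n. y n \<in> B n" "\<And>n. y n \<noteq> id" by metis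
  show ?thesis
  proof
    show "y m \<in> Homeo X K" for m using y(1) openin_subset[OF B(1)] by auto
    show "\<exists>M. \<forall>m\<ge>M. y m \<in> W" if "openin (Homeo_top X K) W" "id \<in> W" for W
      using base(2,3) that y(1) by (meson in_mono)
  qed (rule y(2))
qed

section \<open>The colimit topology\<close>

text \<open>Tracing on a fixed piece commutes with binary intersections and with unions, so the
  predicate given to \<open>topology\<close> is a topology and can be unfolded.\<close>

lemma openin_colimit_topology:
  "openin (colimit_topology I T) U \<longleftrightarrow>
     U \<subseteq> (\<Union>i\<in>I. topspace (T i)) \<and> (\<forall>i\<in>I. openin (T i) (U \<inter> topspace (T i)))"
proof -
  have "istopology (\<lambda>U. U \<subseteq> (\<Union>i\<in>I. topspace (T i)) \<and> (\<forall>i\<in>I. openin (T i) (U \<inter> topspace (T i))))"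
    unfolding istopology_def
  proof (intro conjI allI impI ballI)
    fix A B i assume "A \<subseteq> (\<Union>i\<in>I. topspace (T i)) \<and> (\<forall>i\<in>I. openin (T i) (A \<inter> topspace (T i)))"
      "B \<subseteq> (\<Union>i\<in>I. topspace (T i)) \<and> (\<forall>i\<in>I. openin (T i) (B \<inter> topspace (T i)))" "i \<in> I"
    then have "openin (T i) ((A \<inter> topspace (T i)) \<inter> (B \<inter> topspace (T i)))" by blast
    then show "openin (T i) (A \<inter> B \<inter> topspace (T i))" by (simp add: Int_ac)
  next
    fix \<K> i assume \<K>: "\<forall>A\<in>\<K>. A \<subseteq> (\<Union>i\<in>I. topspace (T i)) \<and> (\<forall>i\<in>I. openin (T i) (A \<inter> topspace (T i)))"
      and "i \<in> I"
    then have "openin (T i) (\<Union>((\<lambda>A. A \<inter> topspace (T i)) ` \<K>))" by blast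
    then show "openin (T i) (\<Union>\<K> \<inter> topspace (T i))" by (simp add: Int_commute Int_Union)
  qed blast+
  then show ?thesis by (simp add: colimit_topology_def)
qed

lemma topspace_colimit_topology [simp]:
  "topspace (colimit_topology I T) = (\<Union>i\<in>I. topspace (T i))"
proof (rule subset_antisym)
  show "topspace (colimit_topology I T) \<subseteq> (\<Union>i\<in>I. topspace (T i))"
    using openin_colimit_topology[of I T "topspace (colimit_topology I T)"] by simp
  have "(\<Union>i\<in>I. topspace (T i)) \<inter> topspace (T i) = topspace (T i)" if "i \<in> I" for i
    using that by blast
  then have "openin (colimit_topology I T) (\<Union>i\<in>I. topspace (T i))"
    unfolding openin_colimit_topology by simp
  then show "(\<Union>i\<in>I. topspace (T i)) \<subseteq> topspace (colimit_topology I T)"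
    by (rule openin_subset)
qed

section \<open>Separation and closed sets in the colimit of the homeomorphism groups\<close>

abbreviation Homeo_colimit :: "'a topology \<Rightarrow> ('a \<Rightarrow> 'a) topology" where
  "Homeo_colimit X \<equiv> colimit_topology {K. compactin X K} (Homeo_top X)"

lemma Homeo_subset_colimit: "compactin X K \<Longrightarrow> Homeo X K \<subseteq> topspace (Homeo_colimit X)"
  by auto

lemma openin_Homeo_colimit_restrict:
  "openin (Homeo_colimit X) U \<Longrightarrow> compactin X K \<Longrightarrow> openin (Homeo_top X K) (U \<inter> Homeo X K)"
  by (simp add: openin_colimit_topology)

text \<open>The colimit topology is finer than the compact-open topology on the union. Compact-open
  neighbourhoods are the concrete open sets used in the separation arguments below.\<close>

lemma openin_Homeo_colimit_if_compact_open:
  "openin (maps_compact_open X) W \<Longrightarrow> openin (Homeo_colimit X) (W \<inter> topspace (Homeo_colimit X))"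
proof -
  assume W: "openin (maps_compact_open X) W"
  have "openin (Homeo_top X K) (W \<inter> (\<Union>K\<in>{K. compactin X K}. Homeo X K) \<inter> Homeo X K)" if "compactin X K" for K
  proof -
    have "W \<inter> (\<Union>K\<in>{K. compactin X K}. Homeo X K) \<inter> Homeo X K = W \<inter> Homeo X K"
      using that by blast
    then show ?thesis using W openin_Homeo_top by metis
  qed
  then show ?thesis by (simp add: openin_colimit_topology)
qed

lemma Homeo_colimit_moves:
  assumes "g \<in> topspace (Homeo_colimit X)"
  shows "x \<notin> topspace X \<Longrightarrow> g x = x" and "x \<in> topspace X \<Longrightarrow> g x \<in> topspace X"
proof -
  obtain K where K: "compactin X K" "g \<in> Homeo X K" using assms by auto
  show "g x = x" if "x \<notin> topspace X"
    using Homeo_fixes[OF K(2)] that compactin_subset_topspace[OF K(1)] by blast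
  show "g x \<in> topspace X" if "x \<in> topspace X"
    using Homeo_continuous_map[OF K(2)] that by (auto simp: continuous_map_def)
qed

text \<open>Two different maps differ at a point of \<open>X\<close>, since both fix everything
  outside the space. A subbasic set for this single point separates them.\<close>

lemma t1_Homeo_colimit:
  assumes "Hausdorff_space X"
  shows "t1_space (Homeo_colimit X)"
  unfolding t1_space_def
proof (intro ballI impI)
  fix g h assume gh: "g \<in> topspace (Homeo_colimit X)" "h \<in> topspace (Homeo_colimit X)" "g \<noteq> h"
  then obtain x where x: "g x \<noteq> h x" by auto
  then have xt: "x \<in> topspace X" using Homeo_colimit_moves(1) gh by metis
  then have "g x \<in> topspace X" "h x \<in> topspace X" using Homeo_colimit_moves(2) gh by metis+
  then obtain U where U: "openin X U" "g x \<in> U" "h x \<notin> U"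
    using assms x Hausdorff_imp_t1_space t1_space_def by metis
  have "openin (Homeo_colimit X) ({f. f ` {x} \<subseteq> U} \<inter> topspace (Homeo_colimit X))"
    using xt U(1) by (intro openin_Homeo_colimit_if_compact_open openin_maps_compact_open) auto
  then show "\<exists>W. openin (Homeo_colimit X) W \<and> g \<in> W \<and> h \<notin> W"
    using gh U by (intro exI[of _ "{f. f ` {x} \<subseteq> U} \<inter> topspace (Homeo_colimit X)"]) auto
qed

text \<open>Within \<open>Homeo X K\<close> a good neighbourhood extends to a compact-open one with
  the same trace. A map outside \<open>Homeo X K\<close> moves some \<open>p\<close> outside
  \<open>K\<close>, while every \<open>x m\<close> fixes \<open>p\<close>; a condition at
  \<open>p\<close> excludes the entire sequence.\<close>

lemma no_cluster_point_in_Homeo_colimit: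
  fixes x :: "nat \<Rightarrow> 'a \<Rightarrow> 'a"
  assumes T2: "Hausdorff_space X" and K: "compactin X K"
    and x: "\<And>m. x m \<in> Homeo X K"
    and nc: "\<And>z. z \<in> Homeo X K \<Longrightarrow> \<exists>U. openin (Homeo_top X K) U \<and> z \<in> U \<and> finite {m. x m \<in> U}"
    and z: "z \<in> topspace (Homeo_colimit X)"
  shows "\<exists>U. openin (Homeo_colimit X) U \<and> z \<in> U \<and> finite {m. x m \<in> U}"
proof (cases "z \<in> Homeo X K")
  case True
  then obtain U where U: "openin (Homeo_top X K) U" "z \<in> U" "finite {m. x m \<in> U}"
    using nc by blast
  then obtain W where W: "openin (maps_compact_open X) W" "U = W \<inter> Homeo X K"
    by (auto simp: openin_Homeo_top)
  let ?W = "W \<inter> topspace (Homeo_colimit X)"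
  have "{m. x m \<in> ?W} \<subseteq> {m. x m \<in> U}" using x W(2) by blast
  then have "finite {m. x m \<in> ?W}" using U(3) finite_subset by blast
  then show ?thesis
    using openin_Homeo_colimit_if_compact_open[OF W(1)] U(2) W(2) z by blast
next
  case False
  obtain L where L: "compactin X L" "z \<in> Homeo X L" using z by auto
  then have "homeomorphic_map X X z" by (auto simp: Homeo_def)
  then obtain p where p: "p \<notin> K" "z p \<noteq> p" using False by (auto simp: Homeo_def)
  have pt: "p \<in> topspace X" using p(2) z Homeo_colimit_moves(1) by metis
  have zt: "z p \<in> topspace X" using pt z Homeo_colimit_moves(2) by metis
  obtain U where U: "openin X U" "z p \<in> U" "p \<notin> U"
    using T2 p(2) pt zt Hausdorff_imp_t1_space t1_space_def by metis
  let ?W = "{f. f ` {p} \<subseteq> U} \<inter> topspace (Homeo_colimit X)"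
  have "openin (Homeo_colimit X) ?W"
    using pt U(1) by (intro openin_Homeo_colimit_if_compact_open openin_maps_compact_open) auto
  moreover have "{m. x m \<in> ?W} = {}"
    using U(3) Homeo_fixes[OF x p(1)] by auto
  then have "finite {m. x m \<in> ?W}" by (simp only: finite.emptyI)
  moreover have "z \<in> ?W" using U(2) z by auto
  ultimately show ?thesis by (intro exI[of _ ?W] conjI)
qed

text \<open>As \<open>y m\<close> tends to the identity, continuity of right division shows that an
  accumulation of the products at \<open>z\<close> would be an accumulation of the
  \<open>x m\<close> at \<open>z\<close>. Arbitrary subsets \<open>S\<close> of the set of products
  are treated because traces on the groups \<open>Homeo X C\<close> must be closed too.\<close>

lemma closedin_Homeo_colimit_products:
  fixes x y :: "nat \<Rightarrow> 'a \<Rightarrow> 'a"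
  assumes T2: "Hausdorff_space X" and grp: "topological_group_of_maps (Homeo_colimit X)"
    and xG: "\<And>m. x m \<in> topspace (Homeo_colimit X)" and yG: "\<And>m. y m \<in> topspace (Homeo_colimit X)"
    and x: "\<And>z. z \<in> topspace (Homeo_colimit X) \<Longrightarrow>
                 \<exists>U. openin (Homeo_colimit X) U \<and> z \<in> U \<and> finite {m. x m \<in> U}"
    and y: "\<And>W. openin (Homeo_colimit X) W \<Longrightarrow> id \<in> W \<Longrightarrow> \<exists>M. \<forall>m\<ge>M. y m \<in> W"
    and S: "S \<subseteq> range (\<lambda>m. x m \<circ> y m)"
  shows "closedin (Homeo_colimit X) S"
proof -
  let ?T = "Homeo_colimit X"
  let ?G = "topspace ?T"
  have cm: "continuous_map (prod_topology ?T ?T) ?T (\<lambda>p. fst p \<circ> snd p)"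
    and ci: "continuous_map ?T ?T (\<lambda>h. inv h)"
    using grp by (auto simp: topological_group_of_maps_def)
  have "continuous_map (prod_topology ?T ?T) (prod_topology ?T ?T) (\<lambda>p. (fst p, inv (snd p)))"
    unfolding continuous_map_pairwise
    using continuous_map_fst continuous_map_compose[OF continuous_map_snd ci]
    by (auto simp: o_def)
  from continuous_map_compose[OF this cm]
  have cd: "continuous_map (prod_topology ?T ?T) ?T (\<lambda>p. fst p \<circ> inv (snd p))"
    by (simp add: o_def)
  have comp: "g \<circ> h \<in> ?G" if "g \<in> ?G" "h \<in> ?G" for g h
  proof -
    have "(g, h) \<in> topspace (prod_topology ?T ?T)" using that by (simp only: topspace_prod_topology) blast
    then have "(\<lambda>p. fst p \<circ> snd p) (g, h) \<in> ?G"
      using cm unfolding continuous_map_def Pi_iff by blast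
    then show ?thesis by (simp only: fst_conv snd_conv)
  qed
  have SG: "S \<subseteq> ?G"
  proof
    fix s assume "s \<in> S"
    then obtain m where "s = x m \<circ> y m" using S by auto
    then show "s \<in> ?G" using comp xG yG by blast
  qed
  have idG: "id \<in> ?G"
    using Homeo_subset_colimit[of X "{}"] id_in_Homeo[of X "{}"] by auto
  have "openin ?T (?G - S)"
  proof (subst openin_subopen, intro ballI)
    fix z assume z: "z \<in> ?G - S"
    obtain U where U: "openin ?T U" "z \<in> U" "finite {m. x m \<in> U}" using x z by blast
    have "openin (prod_topology ?T ?T) {p \<in> topspace (prod_topology ?T ?T). fst p \<circ> inv (snd p) \<in> U}"
      using cd U(1) by (rule openin_continuous_map_preimage)
    moreover have "(z, id) \<in> {p \<in> topspace (prod_topology ?T ?T). fst p \<circ> inv (snd p) \<in> U}"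
      using z idG U(2) by (simp del: topspace_colimit_topology)
    ultimately obtain U1 U2 where U12: "openin ?T U1" "openin ?T U2" "z \<in> U1" "id \<in> U2"
      "U1 \<times> U2 \<subseteq> {p \<in> topspace (prod_topology ?T ?T). fst p \<circ> inv (snd p) \<in> U}"
      unfolding openin_prod_topology_alt by meson
    obtain M where M: "\<forall>m\<ge>M. y m \<in> U2" using y U12 by blast
    let ?D = "{m. x m \<circ> y m \<in> U1}"
    \<comment> \<open>For \<open>m \<ge> M\<close> the factor \<open>y m\<close> lies in
      \<open>U2\<close>, and dividing the product by it on the right returns \<open>x m\<close>,
      which must then lie in \<open>U\<close>.\<close>
    have "?D \<subseteq> {m. x m \<in> U} \<union> {..<M}"
    proof
      fix m assume m: "m \<in> ?D"
      show "m \<in> {m. x m \<in> U} \<union> {..<M}"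
      proof (cases "m < M")
        case False
        then have "(x m \<circ> y m, y m) \<in> U1 \<times> U2" using m M by auto
        then have "x m \<circ> y m \<circ> inv (y m) \<in> U" using U12(5) by auto
        moreover have "surj (y m)"
          using yG[of m] Homeo_bij compactin_subset_topspace by (fastforce simp: bij_is_surj)
        then have "x m \<circ> y m \<circ> inv (y m) = x m"
          by (simp add: fun_eq_iff surj_f_inv_f)
        ultimately show ?thesis by simp
      qed simp
    qed
    then have "finite ?D" using U(3) finite_subset by blast
    \<comment> \<open>Finite sets are closed by T1. Only products belonging to \<open>S\<close> are
      removed from \<open>U1\<close>, so \<open>z\<close>, which lies outside \<open>S\<close>,
      stays in the neighbourhood.\<close>
    then have "finite ((\<lambda>m. x m \<circ> y m) ` ?D \<inter> S)" by simp
    moreover have "(\<lambda>m. x m \<circ> y m) ` ?D \<inter> S \<subseteq> ?G" using SG by (rule le_infI2)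
    ultimately have "closedin ?T ((\<lambda>m. x m \<circ> y m) ` ?D \<inter> S)"
      using t1_Homeo_colimit[OF T2] unfolding t1_space_closedin_finite
      by (intro mp[OF spec[where P = "\<lambda>S. finite S \<and> S \<subseteq> ?G \<longrightarrow> closedin ?T S"]] conjI)
    then have "openin ?T (U1 - ((\<lambda>m. x m \<circ> y m) ` ?D \<inter> S))"
      using U12(1) by (rule openin_diff[rotated])
    moreover have "U1 - ((\<lambda>m. x m \<circ> y m) ` ?D \<inter> S) \<subseteq> ?G - S"
    proof -
      have "U1 \<subseteq> ?G" using U12(1) by (rule openin_subset)
      moreover have "g \<in> (\<lambda>m. x m \<circ> y m) ` ?D" if "g \<in> U1" "g \<in> S" for g
        using S that by blast
      ultimately show ?thesis by blast
    qed
    ultimately show "\<exists>R. openin ?T R \<and> z \<in> R \<and> R \<subseteq> ?G - S"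
      using U12(3) z by (intro exI[of _ "U1 - ((\<lambda>m. x m \<circ> y m) ` ?D \<inter> S)"]) blast
  qed
  then show ?thesis using SG by (simp add: closedin_def del: topspace_colimit_topology)
qed

text \<open>Disjointness from \<open>M\<close> ensures that every product moves a point of the
  corresponding \<open>K n\<close>. Since a compact set meets only finitely many \<open>K n\<close>,
  the union of the sets \<open>F n\<close> has a closed trace on each group, yet continuity of
  multiplication at the pair of identities would force it to contain the identity.\<close>

lemma not_Homeo_family_ACP:
  fixes K :: "nat \<Rightarrow> 'a set"
  assumes X: "locally_compact_space X" "Hausdorff_space X"
    and M: "compactin X M" "metrizable_space (subtopology X M)" "\<not> locally_compact_space (Homeo_top X M)"
    and K: "\<And>n. compactin X (K n)" "\<And>n. metrizable_space (subtopology X (K n))"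
      "\<And>n. Homeo_top X (K n) \<noteq> discrete_topology (Homeo X (K n))"
    and disj: "\<And>n. K n \<inter> M = {}"
    and fin: "\<And>C. compactin X C \<Longrightarrow> finite {n. K n \<inter> C \<noteq> {}}"
  shows "\<not> Homeo_family_ACP X"
proof
  let ?T = "Homeo_colimit X"
  let ?G = "topspace ?T"
  assume "Homeo_family_ACP X"
  then have grp: "topological_group_of_maps ?T" by (simp add: Homeo_family_ACP_def)
  have "first_countable (Homeo_top X M)"
    using second_countable_Homeo_top[OF X(2) M(1,2)] by (rule second_countable_imp_first_countable)
  moreover have "id \<in> topspace (Homeo_top X M)" by simp
  ultimately obtain B :: "nat \<Rightarrow> ('a \<Rightarrow> 'a) set" where
    B: "\<forall>n. openin (Homeo_top X M) (B n) \<and> id \<in> B n"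
    "\<forall>W. openin (Homeo_top X M) W \<and> id \<in> W \<longrightarrow> (\<exists>n. B n \<subseteq> W)"
    using decreasing_neighbourhood_base by metis
  have "\<exists>x :: nat \<Rightarrow> 'a \<Rightarrow> 'a. range x \<subseteq> B n \<and>
     (\<forall>z\<in>Homeo X M. \<exists>U. openin (Homeo_top X M) U \<and> z \<in> U \<and> finite {m. x m \<in> U})" for n
    using Homeo_sequence_without_cluster_point[OF X M, of "B n"] B(1) by metis
  then obtain x :: "nat \<Rightarrow> nat \<Rightarrow> 'a \<Rightarrow> 'a" where x: "\<And>n. range (x n) \<subseteq> B n"
     "\<And>n z. z \<in> Homeo X M \<Longrightarrow> \<exists>U. openin (Homeo_top X M) U \<and> z \<in> U \<and> finite {m. x n m \<in> U}"
    by metis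
  have xM: "x n m \<in> Homeo X M" for n m
    using x(1)[of n] B(1) openin_subset[of "Homeo_top X M" "B n"] by auto
  have "\<exists>y :: nat \<Rightarrow> 'a \<Rightarrow> 'a. (\<forall>m. y m \<in> Homeo X (K n) \<and> y m \<noteq> id) \<and>
     (\<forall>W. openin (Homeo_top X (K n)) W \<and> id \<in> W \<longrightarrow> (\<exists>M. \<forall>m\<ge>M. y m \<in> W))" for n
    using Homeo_sequence_tendsto_id[OF X(2) K(1)[of n] K(2)[of n] K(3)[of n]] by metis
  then obtain y :: "nat \<Rightarrow> nat \<Rightarrow> 'a \<Rightarrow> 'a" where y: "\<And>n m. y n m \<in> Homeo X (K n)" "\<And>n m. y n m \<noteq> id"
     "\<And>n W. openin (Homeo_top X (K n)) W \<Longrightarrow> id \<in> W \<Longrightarrow> \<exists>M. \<forall>m\<ge>M. y n m \<in> W"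
    by metis
  have xG: "x n m \<in> ?G" and yG: "y n m \<in> ?G" for n m
    using xM y(1) Homeo_subset_colimit M(1) K(1) by blast+
  have y_lim: "\<exists>M. \<forall>m\<ge>M. y n m \<in> W" if W: "openin ?T W" "id \<in> W" for n W
    using y(3)[OF openin_Homeo_colimit_restrict[OF W(1) K(1)], of n] W(2) by auto
  define F where "F n = range (\<lambda>m. x n m \<circ> y n m)" for n
  have closed_part: "closedin ?T S" if "S \<subseteq> F n" for S n
  proof (rule closedin_Homeo_colimit_products[OF X(2) grp xG yG])
    show "\<exists>U. openin ?T U \<and> z \<in> U \<and> finite {m. x n m \<in> U}" if "z \<in> ?G" for z
      using no_cluster_point_in_Homeo_colimit[OF X(2) M(1) xM x(2) that] .
  qed (use y_lim that F_def in auto)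
  \<comment> \<open>\<open>y n m\<close> maps \<open>K n\<close> to itself and \<open>x n m\<close>
    fixes \<open>K n\<close> pointwise, so a point moved by \<open>y n m\<close> is also moved by
    the product.\<close>
  have moves: "\<exists>p\<in>K n. (x n m \<circ> y n m) p \<noteq> p" for n m
  proof -
    obtain p where p: "y n m p \<noteq> p" using y(2)[of n m] by (auto simp: fun_eq_iff)
    then have "p \<in> K n" using Homeo_fixes[OF y(1)] by blast
    moreover have "y n m p \<in> K n"
      using calculation Homeo_image[OF y(1) compactin_subset_topspace[OF K(1)]] by blast
    then have "x n m (y n m p) = y n m p" using disj Homeo_fixes[OF xM] by blast
    ultimately show ?thesis using p by (intro bexI[of _ p]) auto
  qed
  have id_notin: "id \<notin> (\<Union>n. F n)"
  proof
    assume "id \<in> (\<Union>n. F n)"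
    then obtain n m where "id = x n m \<circ> y n m" by (auto simp: F_def)
    then show False using moves[of n m] by (metis id_apply)
  qed
  have "openin ?T (?G - (\<Union>n. F n))"
    unfolding openin_colimit_topology
  proof (intro conjI ballI)
    show "?G - (\<Union>n. F n) \<subseteq> (\<Union>i\<in>{K. compactin X K}. topspace (Homeo_top X i))" by auto
    fix C assume "C \<in> {K. compactin X K}"
    then have C: "compactin X C" by simp
    \<comment> \<open>If \<open>C\<close> misses \<open>K n\<close>, then a product in
      \<open>F n\<close> moves a point outside \<open>C\<close> and cannot belong to
      \<open>Homeo X C\<close>.\<close>
    have "{n. F n \<inter> Homeo X C \<noteq> {}} \<subseteq> {n. K n \<inter> C \<noteq> {}}"
    proof clarify
      fix n assume "F n \<inter> Homeo X C \<noteq> {}" and KC: "K n \<inter> C = {}"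
      then obtain m where "x n m \<circ> y n m \<in> Homeo X C" by (auto simp: F_def)
      moreover obtain p where "p \<in> K n" "(x n m \<circ> y n m) p \<noteq> p" using moves by blast
      ultimately show "False" using Homeo_fixes[of "x n m \<circ> y n m" X C p] KC by blast
    qed
    then have fin': "finite {n. F n \<inter> Homeo X C \<noteq> {}}" using fin[OF C] finite_subset by blast
    have "closedin ?T (\<Union>n\<in>{n. F n \<inter> Homeo X C \<noteq> {}}. F n \<inter> Homeo X C)"
      using fin' by (intro closedin_Union) (auto intro: closed_part[OF Int_lower1])
    moreover have "(\<Union>n\<in>{n. F n \<inter> Homeo X C \<noteq> {}}. F n \<inter> Homeo X C) = (\<Union>n. F n) \<inter> Homeo X C"
      by blast
    ultimately have "openin ?T (?G - (\<Union>n. F n) \<inter> Homeo X C)"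
      by (metis closedin_def)
    then have "openin (Homeo_top X C) ((?G - (\<Union>n. F n) \<inter> Homeo X C) \<inter> Homeo X C)"
      using C by (rule openin_Homeo_colimit_restrict)
    moreover have "(?G - (\<Union>n. F n) \<inter> Homeo X C) \<inter> Homeo X C = (?G - (\<Union>n. F n)) \<inter> topspace (Homeo_top X C)"
      by auto
    ultimately show "openin (Homeo_top X C) ((?G - (\<Union>n. F n)) \<inter> topspace (Homeo_top X C))" by simp
  qed
  moreover have cm: "continuous_map (prod_topology ?T ?T) ?T (\<lambda>p. fst p \<circ> snd p)"
    using grp by (auto simp: topological_group_of_maps_def)
  ultimately have "openin (prod_topology ?T ?T)
      {p \<in> topspace (prod_topology ?T ?T). fst p \<circ> snd p \<in> ?G - (\<Union>n. F n)}"
    by (rule openin_continuous_map_preimage[rotated])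
  moreover have idG: "id \<in> ?G"
    using Homeo_subset_colimit[OF M(1)] id_in_Homeo by blast
  then have "(id, id) \<in> {p \<in> topspace (prod_topology ?T ?T). fst p \<circ> snd p \<in> ?G - (\<Union>n. F n)}"
    using id_notin by (simp del: topspace_colimit_topology)
  ultimately obtain U1 U2 where U: "openin ?T U1" "openin ?T U2" "id \<in> U1" "id \<in> U2"
      "U1 \<times> U2 \<subseteq> {p \<in> topspace (prod_topology ?T ?T). fst p \<circ> snd p \<in> ?G - (\<Union>n. F n)}"
      unfolding openin_prod_topology_alt by meson
  \<comment> \<open>The order of choice matters: \<open>U1\<close> determines \<open>n\<close>,
    after which all \<open>x n m\<close> lie in \<open>U1\<close>, and \<open>m\<close> remains free
    to bring \<open>y n m\<close> into \<open>U2\<close>.\<close>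
  obtain n where n: "B n \<subseteq> U1 \<inter> Homeo X M"
    using B(2) openin_Homeo_colimit_restrict[OF U(1) M(1)] U(3) id_in_Homeo by (metis IntI)
  obtain m where m: "y n m \<in> U2" using y_lim[OF U(2,4), of n] by blast
  have "x n m \<in> U1" using n x(1)[of n] by blast
  then have "(x n m, y n m) \<in> U1 \<times> U2" using m by simp
  then have "x n m \<circ> y n m \<notin> (\<Union>n. F n)" using U(5) by auto
  then show False by (auto simp: F_def)
qed

section \<open>Locally finite families of compact neighbourhoods\<close>

lemma closed_discrete_real_function:
  assumes "normal_space Y" "closedin Y T" "infinite T" "subtopology Y T = discrete_topology T"
  shows "\<exists>(t :: nat \<Rightarrow> 'b) f. inj t \<and> range t \<subseteq> T \<and> continuous_map Y euclideanreal f \<and> (\<forall>n. f (t n) = real n)"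
proof -
  obtain t :: "nat \<Rightarrow> 'b" where t: "inj t" "range t \<subseteq> T"
    using assms(3) infinite_countable_subset by blast
  define S where "S = range t"
  \<comment> \<open>Every subset of a closed discrete set is again closed and discrete. Hence
    numbering the points of \<open>S\<close> is a continuous real function, to which Tietze
    extension applies.\<close>
  have "closedin (subtopology Y T) S"
    unfolding assms(4) using t(2) by (simp add: S_def)
  then have S: "closedin Y S" using assms(2) by (rule closedin_trans_full)
  have "subtopology Y S = subtopology (subtopology Y T) S"
    using t(2) by (simp add: subtopology_subtopology S_def Int_absorb1)
  also have "\<dots> = discrete_topology S"
    unfolding assms(4) using t(2) by (simp add: S_def Int_absorb1)
  finally have "continuous_map (subtopology Y S) euclideanreal (\<lambda>x. real (inv t x))"
    by simp
  then obtain f where f: "continuous_map Y euclideanreal f" "\<And>x. x \<in> S \<Longrightarrow> f x = real (inv t x)"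
    using Tietze_extension_realinterval[OF assms(1) S is_interval_univ, of "\<lambda>x. real (inv t x)"] by auto
  have "f (t n) = real n" for n using f(2)[of "t n"] t(1) by (simp add: S_def)
  then show ?thesis using t f(1) by blast
qed

text \<open>Local compactness shrinks each \<open>N n\<close> into the strip where \<open>f\<close>
  is near n. The radius 1/3 is below 1/2, so strips for different integers are disjoint.\<close>

lemma separated_compact_neighbourhoods:
  fixes f :: "'a \<Rightarrow> real"
  assumes X: "locally_compact_space X" "Hausdorff_space X" and A: "A \<subseteq> topspace X"
    and f: "continuous_map (subtopology X A) euclideanreal f"
    and N: "\<And>n. openin X (N n)" "\<And>n. N n \<subseteq> A" "\<And>n. t n \<in> N n" "\<And>n. f (t n) = real n"
  shows "\<exists>V :: nat \<Rightarrow> 'a set. \<forall>n. openin X (V n) \<and> t n \<in> V n \<and> compactin X (X closure_of V n) \<and>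
     X closure_of V n \<subseteq> N n \<and> f ` (X closure_of V n) \<subseteq> {real n - 1/3 <..< real n + 1/3}"
proof (rule choice, intro allI)
  fix n
  have "openin (subtopology X A) {x \<in> topspace (subtopology X A). f x \<in> {real n - 1/3 <..< real n + 1/3}}"
    using f by (rule openin_continuous_map_preimage) simp
  \<comment> \<open>The strip is open only relative to \<open>A\<close>. Since \<open>N n\<close> is
    open in \<open>X\<close> and contained in \<open>A\<close>, the set
    \<open>U \<inter> N n\<close> is open in \<open>X\<close> and still inside the strip.\<close>
  then obtain U where U: "openin X U"
    "{x \<in> topspace (subtopology X A). f x \<in> {real n - 1/3 <..< real n + 1/3}} = U \<inter> A"
    by (auto simp: openin_subtopology)
  have tU: "t n \<in> U \<inter> N n"
  proof -
    have "t n \<in> {x \<in> topspace (subtopology X A). f x \<in> {real n - 1/3 <..< real n + 1/3}}"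
      using N(2,3,4)[of n] A by auto
    then show ?thesis using U(2) N(3) by blast
  qed
  have "openin X (U \<inter> N n)" using U(1) N(1) by blast
  moreover have "neighbourhood_base_of (\<lambda>C. compactin X C \<and> closedin X C) X"
    using X locally_compact_space_neighbourhood_base_closedin by blast
  ultimately obtain V C where V: "openin X V" "compactin X C" "closedin X C" "t n \<in> V" "V \<subseteq> C" "C \<subseteq> U \<inter> N n"
    unfolding neighbourhood_base_of using tU by meson
  have cl: "X closure_of V \<subseteq> C" using V by (simp add: closure_of_minimal)
  then have "compactin X (X closure_of V)" using V(2) by (meson closed_compactin closedin_closure_of)
  moreover have "X closure_of V \<subseteq> U \<inter> A" using cl V(6) N(2) by blast
  then have "f ` (X closure_of V) \<subseteq> {real n - 1/3 <..< real n + 1/3}"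
    unfolding U(2)[symmetric] by blast
  ultimately show "\<exists>V. openin X V \<and> t n \<in> V \<and> compactin X (X closure_of V) \<and>
     X closure_of V \<subseteq> N n \<and> f ` (X closure_of V) \<subseteq> {real n - 1/3 <..< real n + 1/3}"
    using V(1,4,6) cl by (intro exI[of _ V]) auto
qed

text \<open>\<open>f\<close> is bounded on the compact set \<open>C \<inter> A\<close>, whereas its
  values on \<open>K n\<close> are close to n.\<close>

lemma compact_meets_finitely_many:
  fixes f :: "'a \<Rightarrow> real"
  assumes A: "closedin X A" and f: "continuous_map (subtopology X A) euclideanreal f"
    and K: "\<And>n. K n \<subseteq> A" "\<And>n::nat. f ` K n \<subseteq> {real n - 1/3 <..< real n + 1/3}"
    and C: "compactin X C"
  shows "finite {n. K n \<inter> C \<noteq> {}}"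
proof -
  have "compactin X (C \<inter> A)" using C A by (rule compact_Int_closedin)
  then have "compactin (subtopology X A) (C \<inter> A)" by (simp add: compactin_subtopology)
  then have "compactin euclideanreal (f ` (C \<inter> A))" using f by (rule image_compactin)
  then have "bounded (f ` (C \<inter> A))" by (simp add: compact_imp_bounded)
  then obtain b where b: "\<And>c. c \<in> C \<inter> A \<Longrightarrow> \<bar>f c\<bar> \<le> b"
    unfolding bounded_iff by auto
  have "{n. K n \<inter> C \<noteq> {}} \<subseteq> {n. real n \<le> b + 1}"
  proof
    fix n assume "n \<in> {n. K n \<inter> C \<noteq> {}}"
    then obtain c where "c \<in> K n" "c \<in> C" by blast
    then have "f c \<in> {real n - 1/3 <..< real n + 1/3}" "\<bar>f c\<bar> \<le> b" using K b by blast+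
    then show "n \<in> {n. real n \<le> b + 1}" by auto
  qed
  moreover have "{n. real n \<le> b + 1} \<subseteq> {..nat \<lceil>b + 1\<rceil>}" by (auto, linarith)
  ultimately show ?thesis by (meson finite_atMost finite_subset)
qed

text \<open>Metrizability of \<open>A\<close> is used twice: it makes \<open>A\<close> normal, which
  yields the function \<open>f\<close>, and it passes to the compact closures inside
  \<open>A\<close>. Working in the interior of \<open>A\<close> keeps the chosen neighbourhoods open
  in \<open>X\<close>.\<close>

lemma not_Homeo_family_ACP_if_discrete_closed_set:
  assumes X: "locally_compact_space X" "Hausdorff_space X"
    and M: "compactin X M" "metrizable_space (subtopology X M)" "\<not> locally_compact_space (Homeo_top X M)"
    and A: "closedin X A" "metrizable_space (subtopology X A)"
    and T: "T \<subseteq> X interior_of A" "infinite_discrete_closed_in X T"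
    and nd: "\<And>t V. t \<in> T \<Longrightarrow> neighbourhood_of X V t \<Longrightarrow> compactin X (X closure_of V) \<Longrightarrow>
       Homeo_top X (X closure_of V) \<noteq> discrete_topology (Homeo X (X closure_of V))"
  shows "\<not> Homeo_family_ACP X"
proof -
  have TA: "T \<subseteq> A" using T(1) interior_of_subset[of X A] by blast
  have T': "closedin X T" "infinite T" "subtopology X T = discrete_topology T"
    using T(2) by (auto simp: infinite_discrete_closed_in_def)
  have "closedin (subtopology X A) T" using T'(1) TA by (rule closedin_subset_topspace)
  moreover have "subtopology (subtopology X A) T = discrete_topology T"
    using T'(3) TA by (simp add: subtopology_subtopology Int_absorb1)
  ultimately obtain t :: "nat \<Rightarrow> 'a" and f where t: "inj t" "range t \<subseteq> T"
    "continuous_map (subtopology X A) euclideanreal f" "\<forall>n. f (t n) = real n"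
    using closed_discrete_real_function[OF metrizable_imp_normal_space[OF A(2)] _ T'(2)] by blast
  have ti: "t n \<in> X interior_of A" for n using t(2) T(1) by blast
  obtain V :: "nat \<Rightarrow> 'a set" where V: "\<forall>n. openin X (V n) \<and> t n \<in> V n \<and> compactin X (X closure_of V n) \<and>
     X closure_of V n \<subseteq> X interior_of A \<and> f ` (X closure_of V n) \<subseteq> {real n - 1/3 <..< real n + 1/3}"
    using separated_compact_neighbourhoods[OF X closedin_subset[OF A(1)] t(3), of "\<lambda>n. X interior_of A" t]
      ti t(4) by (auto simp: interior_of_subset)
  have VA: "X closure_of V n \<subseteq> A" for n using V interior_of_subset by (metis subset_trans)
  have fin: "finite {n. X closure_of V n \<inter> C \<noteq> {}}" if "compactin X C" for C
    by (rule compact_meets_finitely_many[OF A(1) t(3) VA _ that]) (use V in blast)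
  \<comment> \<open>Only finitely many closures meet \<open>M\<close>; shifting the index by
    \<open>n0\<close> skips them all.\<close>
  obtain n0 where n0: "\<forall>n\<in>{n. X closure_of V n \<inter> M \<noteq> {}}. n < n0"
    using fin[OF M(1)] finite_nat_set_iff_bounded by metis
  show ?thesis
  proof (rule not_Homeo_family_ACP[OF X M, where K = "\<lambda>n. X closure_of V (n0 + n)"])
    show "compactin X (X closure_of V (n0 + n))" for n using V by blast
    show "metrizable_space (subtopology X (X closure_of V (n0 + n)))" for n
      using metrizable_space_subtopology[OF A(2), of "X closure_of V (n0 + n)"] VA
      by (simp add: subtopology_subtopology Int_absorb1)
    show "Homeo_top X (X closure_of V (n0 + n)) \<noteq> discrete_topology (Homeo X (X closure_of V (n0 + n)))" for n
    proof (rule nd)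
      show "t (n0 + n) \<in> T" using t(2) by blast
      show "neighbourhood_of X (V (n0 + n)) (t (n0 + n))"
        unfolding neighbourhood_of_def using V openin_subset[of X "V (n0 + n)"]
        by (intro conjI exI[of _ "V (n0 + n)"]) auto
      show "compactin X (X closure_of V (n0 + n))" using V by blast
    qed
    show "X closure_of V (n0 + n) \<inter> M = {}" for n using n0 by force
    fix C assume "compactin X C"
    then have "finite ((\<lambda>n. n0 + n) -` {n. X closure_of V n \<inter> C \<noteq> {}})"
      using fin by (intro finite_vimageI) (auto simp: inj_on_def)
    then show "finite {n. X closure_of V (n0 + n) \<inter> C \<noteq> {}}" by (simp add: vimage_def)
  qed
qed

section \<open>Metrization\<close>

text \<open>For each pair of basic sets with the closure of the first inside the second, choose a
  Urysohn function. There are countably many pairs, and the functions together embed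
  \<open>Y\<close> in a countable power of the reals.\<close>

lemma Urysohn_metrization:
  assumes sc: "second_countable Y" and nor: "normal_space Y" and T2: "Hausdorff_space Y"
  shows "metrizable_space Y"
proof -
  obtain \<B> where \<B>: "countable \<B>" "\<And>V. V \<in> \<B> \<Longrightarrow> openin Y V"
    "\<And>U x. openin Y U \<Longrightarrow> x \<in> U \<Longrightarrow> \<exists>V\<in>\<B>. x \<in> V \<and> V \<subseteq> U"
    using sc unfolding second_countable_def by metis
  have reg: "regular_space Y" using nor T2 by (simp add: Hausdorff_imp_t1_space normal_t1_imp_regular_space)
  define P where "P = {(U, V). U \<in> \<B> \<and> V \<in> \<B> \<and> Y closure_of U \<subseteq> V}"
  have "P \<subseteq> \<B> \<times> \<B>" by (auto simp: P_def)
  then have cP: "countable P" using \<B>(1) countable_subset countable_SIGMA by metis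
  have "\<exists>f. continuous_map Y euclideanreal f \<and> f ` (Y closure_of fst p) \<subseteq> {0} \<and> f ` (topspace Y - snd p) \<subseteq> {1}"
    if p: "p \<in> P" for p
  proof -
    have "closedin Y (topspace Y - snd p)" using p \<B>(2) by (auto simp: P_def)
    moreover have "disjnt (Y closure_of fst p) (topspace Y - snd p)" using p by (auto simp: P_def disjnt_iff)
    ultimately obtain f where "continuous_map Y (top_of_set {0..1}) f" "f ` (Y closure_of fst p) \<subseteq> {0::real}"
      "f ` (topspace Y - snd p) \<subseteq> {1}"
      using Urysohn_lemma[OF nor closedin_closure_of, of _ "fst p" 0 1] by (metis zero_le_one)
    then show ?thesis by (auto simp: continuous_map_in_subtopology)
  qed
  then obtain f where f: "\<And>p. p \<in> P \<Longrightarrow> continuous_map Y euclideanreal (f p)"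
    "\<And>p. p \<in> P \<Longrightarrow> f p ` (Y closure_of fst p) \<subseteq> {0}" "\<And>p. p \<in> P \<Longrightarrow> f p ` (topspace Y - snd p) \<subseteq> {1}"
    by metis
  \<comment> \<open>Regularity supplies a basic \<open>W\<close> around \<open>x\<close> with
    closure inside a basic \<open>V \<subseteq> U\<close>. The function of this pair is 0 at
    \<open>x\<close> and 1 off \<open>V\<close>, so values below 1 occur only in
    \<open>U\<close>.\<close>
  have separate: "\<exists>p\<in>P. f p x = 0 \<and> (\<forall>y\<in>topspace Y. f p y < 1 \<longrightarrow> y \<in> U)" if U: "openin Y U" "x \<in> U" for U x
  proof -
    obtain V where V: "V \<in> \<B>" "x \<in> V" "V \<subseteq> U" using \<B>(3) U by blast
    obtain O1 C1 where O1: "openin Y O1" "closedin Y C1" "x \<in> O1" "O1 \<subseteq> C1" "C1 \<subseteq> V"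
      using reg \<B>(2)[OF V(1)] V(2)
      unfolding neighbourhood_base_of_closedin[symmetric] neighbourhood_base_of by meson
    obtain W where W: "W \<in> \<B>" "x \<in> W" "W \<subseteq> O1" using \<B>(3) O1 by blast
    have "Y closure_of W \<subseteq> C1" using W(3) O1 by (meson closure_of_minimal subset_trans)
    then have p: "(W, V) \<in> P" using W V O1(5) by (auto simp: P_def)
    have "x \<in> Y closure_of W" using W(2) closure_of_subset[OF openin_subset[OF \<B>(2)[OF W(1)]]] by blast
    then have "f (W, V) x = 0" using f(2)[OF p] by auto
    moreover have "y \<in> U" if "y \<in> topspace Y" "f (W, V) y < 1" for y
      using f(3)[OF p] that V(3) by force
    ultimately show ?thesis using p by blast
  qed
  define e where "e x = (\<lambda>p\<in>P. f p x)" for x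
  let ?Q = "product_topology (\<lambda>_. euclideanreal) P"
  let ?Z = "subtopology ?Q (e ` topspace Y)"
  have eQ: "e x \<in> topspace ?Q" for x by (simp add: e_def)
  have "homeomorphic_map Y ?Z e"
  proof (rule bijective_open_imp_homeomorphic_map)
    show "continuous_map Y ?Z e"
      unfolding continuous_map_in_subtopology continuous_map_componentwise
      using f(1) by (auto simp: e_def)
    show "e ` topspace Y = topspace ?Z" using eQ by auto
    show "inj_on e (topspace Y)"
    proof (rule inj_onI, rule ccontr)
      fix x y assume xy: "x \<in> topspace Y" "y \<in> topspace Y" "e x = e y" "x \<noteq> y"
      then obtain U where U: "openin Y U" "x \<in> U" "y \<notin> U"
        using T2 Hausdorff_imp_t1_space t1_space_def by metis
      then obtain p where p: "p \<in> P" "f p x = 0" "\<forall>y\<in>topspace Y. f p y < 1 \<longrightarrow> y \<in> U"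
        using separate by metis
      have "f p x = f p y" using xy(3) p(1) by (metis e_def restrict_apply')
      then show False using p xy U(3) by auto
    qed
    show "open_map Y ?Z e"
      unfolding open_map_def
    proof (intro allI impI)
      fix U assume U: "openin Y U"
      show "openin ?Z (e ` U)"
      proof (subst openin_subopen, intro ballI)
        fix w assume "w \<in> e ` U"
        then obtain x where x: "x \<in> U" "w = e x" by blast
        obtain p where p: "p \<in> P" "f p x = 0" "\<forall>y\<in>topspace Y. f p y < 1 \<longrightarrow> y \<in> U"
          using separate[OF U x(1)] by blast
        \<comment> \<open>The single coordinate \<open>p\<close> already cuts out a neighbourhood of
          \<open>w\<close> in the image of \<open>e\<close> that lies in the image of
          \<open>U\<close>.\<close>
        let ?W = "{v \<in> topspace ?Q. v p \<in> {..<1}}"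
        have "openin ?Q ?W"
          using continuous_map_product_projection[OF p(1), of "\<lambda>_. euclideanreal"]
          by (rule openin_continuous_map_preimage) simp
        then have "openin ?Z (?W \<inter> e ` topspace Y)" by (auto simp: openin_subtopology)
        moreover have "w \<in> ?W \<inter> e ` topspace Y"
          using x p openin_subset[OF U] eQ by (auto simp: e_def)
        moreover have "?W \<inter> e ` topspace Y \<subseteq> e ` U"
          using p by (auto simp: e_def)
        ultimately show "\<exists>T. openin ?Z T \<and> w \<in> T \<and> T \<subseteq> e ` U" by blast
      qed
    qed
  qed
  then have "Y homeomorphic_space ?Z" by (rule homeomorphic_map_imp_homeomorphic_space)
  moreover have "metrizable_space ?Q"
    unfolding metrizable_space_product_topology
    using cP metrizable_space_euclidean by (auto intro: countable_subset[of _ P])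
  then have "metrizable_space ?Z" by (rule metrizable_space_subtopology)
  ultimately show ?thesis by (simp add: homeomorphic_metrizable_space)
qed

text \<open>Bases of open subspaces consist of open sets of \<open>Y\<close>, and each open set is
  the union of its traces on the cover; countably many countable bases combine to one.\<close>

lemma second_countable_open_cover:
  assumes "countable \<U>" and op: "\<And>U. U \<in> \<U> \<Longrightarrow> openin Y U"
    and sc: "\<And>U. U \<in> \<U> \<Longrightarrow> second_countable (subtopology Y U)"
    and cov: "topspace Y \<subseteq> \<Union>\<U>"
  shows "second_countable Y"
proof -
  have "\<forall>U\<in>\<U>. \<exists>\<B>. countable \<B> \<and> (\<forall>V\<in>\<B>. openin Y V) \<and>
     (\<forall>W x. openin Y W \<and> W \<subseteq> U \<and> x \<in> W \<longrightarrow> (\<exists>V\<in>\<B>. x \<in> V \<and> V \<subseteq> W))"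
  proof
    fix U assume U: "U \<in> \<U>"
    then show "\<exists>\<B>. countable \<B> \<and> (\<forall>V\<in>\<B>. openin Y V) \<and>
     (\<forall>W x. openin Y W \<and> W \<subseteq> U \<and> x \<in> W \<longrightarrow> (\<exists>V\<in>\<B>. x \<in> V \<and> V \<subseteq> W))"
      using sc[OF U] unfolding second_countable_def openin_open_subtopology[OF op[OF U]] by metis
  qed
  from bchoice[OF this] obtain \<B> where "\<forall>U\<in>\<U>. countable (\<B> U) \<and> (\<forall>V\<in>\<B> U. openin Y V) \<and>
     (\<forall>W x. openin Y W \<and> W \<subseteq> U \<and> x \<in> W \<longrightarrow> (\<exists>V\<in>\<B> U. x \<in> V \<and> V \<subseteq> W))"
    ..
  then have \<B>: "\<And>U. U \<in> \<U> \<Longrightarrow> countable (\<B> U)" "\<And>U V. U \<in> \<U> \<Longrightarrow> V \<in> \<B> U \<Longrightarrow> openin Y V"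
     "\<And>U W x. U \<in> \<U> \<Longrightarrow> openin Y W \<Longrightarrow> W \<subseteq> U \<Longrightarrow> x \<in> W \<Longrightarrow> \<exists>V\<in>\<B> U. x \<in> V \<and> V \<subseteq> W"
    by auto
  show ?thesis
    unfolding second_countable_def
  proof (intro exI[of _ "\<Union>(\<B> ` \<U>)"] conjI allI impI ballI)
    show "countable (\<Union>(\<B> ` \<U>))" using assms(1) \<B>(1) by blast
    show "openin Y V" if "V \<in> \<Union>(\<B> ` \<U>)" for V using that \<B>(2) by blast
    fix W x assume W: "openin Y W \<and> x \<in> W"
    then have "x \<in> topspace Y" using openin_subset by blast
    then obtain U where U: "U \<in> \<U>" "x \<in> U" using cov by blast
    then have "openin Y (W \<inter> U)" using W op by blast
    then obtain V where "V \<in> \<B> U" "x \<in> V" "V \<subseteq> W \<inter> U"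
      using \<B>(3)[OF U(1), of "W \<inter> U" x] W U(2) by blast
    then show "\<exists>V\<in>\<Union>(\<B> ` \<U>). x \<in> V \<and> V \<subseteq> W" using U(1) by blast
  qed
qed

section \<open>Metrizability of compact sets and of suitable regular closed sets\<close>

lemma compact_subset_of_metrizable_second_countable:
  assumes "compactin X C" "C \<subseteq> N" "metrizable_space (subtopology X N)"
  shows "second_countable (subtopology X C)"
proof (rule compact_metrizable_imp_second_countable)
  show "compact_space (subtopology X C)" using assms(1) by (rule compact_space_subtopology)
  show "metrizable_space (subtopology X C)"
    using metrizable_space_subtopology[OF assms(3), of C] assms(2)
    by (simp add: subtopology_subtopology Int_absorb1)
qed

text \<open>A compact neighbourhood inside a metrizable one is second countable. Finitely many of
  the resulting open sets cover \<open>M\<close>, so \<open>M\<close> is second countable, and being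
  compact Hausdorff it is normal and Urysohn metrization applies.\<close>

lemma compactin_locally_metrizable_imp_metrizable:
  assumes X: "locally_compact_space X" "Hausdorff_space X" "locally_metrizable_space X"
    and M: "compactin X M"
  shows "metrizable_space (subtopology X M)"
proof -
  have Mt: "M \<subseteq> topspace X" using M by (rule compactin_subset_topspace)
  have "\<exists>V. openin X V \<and> x \<in> V \<and> second_countable (subtopology X V)" if x: "x \<in> M" for x
  proof -
    obtain N where N: "openin X N" "x \<in> N" "metrizable_space (subtopology X N)"
      using X(3) x Mt unfolding locally_metrizable_space_def by blast
    have "neighbourhood_base_of (compactin X) X"
      using X locally_compact_space_neighbourhood_base by blast
    then obtain V C where V: "openin X V" "compactin X C" "x \<in> V" "V \<subseteq> C" "C \<subseteq> N"
      unfolding neighbourhood_base_of using N by meson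
    have "second_countable (subtopology X C)"
      using compact_subset_of_metrizable_second_countable[OF V(2,5) N(3)] .
    then have "second_countable (subtopology (subtopology X C) V)"
      by (rule second_countable_subtopology)
    then show ?thesis using V by (auto simp: subtopology_subtopology Int_absorb1)
  qed
  then obtain V where V: "\<And>x. x \<in> M \<Longrightarrow> openin X (V x)" "\<And>x. x \<in> M \<Longrightarrow> x \<in> V x"
    "\<And>x. x \<in> M \<Longrightarrow> second_countable (subtopology X (V x))"
    by metis
  have "\<exists>\<U>. finite \<U> \<and> \<U> \<subseteq> V ` M \<and> M \<subseteq> \<Union>\<U>"
    by (rule compactinD[OF M]) (use V in auto)
  then obtain F where F: "finite F" "F \<subseteq> M" "M \<subseteq> \<Union>(V ` F)"
    by (metis finite_subset_image)
  let ?Y = "subtopology X M"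
  have cY: "compact_space ?Y" using M by (rule compact_space_subtopology)
  have T2: "Hausdorff_space ?Y" using X(2) by (rule Hausdorff_space_subtopology)
  have "second_countable ?Y"
  proof (rule second_countable_open_cover[of "(\<lambda>x. V x \<inter> M) ` F"])
    show "countable ((\<lambda>x. V x \<inter> M) ` F)" using F(1) by (simp add: countable_finite)
    show "topspace ?Y \<subseteq> \<Union>((\<lambda>x. V x \<inter> M) ` F)" using F(3) by auto
    fix U assume "U \<in> (\<lambda>x. V x \<inter> M) ` F"
    then obtain x where x: "x \<in> M" "U = V x \<inter> M" using F(2) by blast
    then show "openin ?Y U" using V(1) openin_subtopology by blast
    have "second_countable (subtopology (subtopology X (V x)) M)"
      using V(3)[OF x(1)] by (rule second_countable_subtopology)
    moreover have "M \<inter> (V x \<inter> M) = V x \<inter> M" by blast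
    ultimately show "second_countable (subtopology ?Y U)"
      using x(2) by (simp add: subtopology_subtopology)
  qed
  then show ?thesis
    using Urysohn_metrization compact_Hausdorff_or_regular_imp_normal_space[OF cY] T2 by blast
qed

lemma regular_closed_in_closure_of_open:
  assumes "openin X U"
  shows "regular_closed_in X (X closure_of U)"
  unfolding regular_closed_in_def
proof (rule subset_antisym)
  show "X closure_of (X interior_of (X closure_of U)) \<subseteq> X closure_of U"
    by (simp add: closure_of_minimal interior_of_subset)
  have "U \<subseteq> X closure_of U" using assms by (simp add: closure_of_subset openin_subset)
  then have "U \<subseteq> X interior_of (X closure_of U)" using assms by (simp add: interior_of_maximal)
  then show "X closure_of U \<subseteq> X closure_of (X interior_of (X closure_of U))"
    by (rule closure_of_mono)
qed

lemma infinite_discrete_closed_in_subset: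
  assumes "infinite_discrete_closed_in X T" "S \<subseteq> T" "infinite S"
  shows "infinite_discrete_closed_in X S"
proof -
  have T: "closedin X T" "subtopology X T = discrete_topology T"
    using assms(1) by (auto simp: infinite_discrete_closed_in_def)
  have "closedin (subtopology X T) S" unfolding T(2) using assms(2) by simp
  then have "closedin X S" using T(1) by (rule closedin_trans_full)
  moreover have "subtopology X S = subtopology (subtopology X T) S"
    using assms(2) by (simp add: subtopology_subtopology Int_absorb1)
  then have "subtopology X S = discrete_topology S"
    unfolding T(2) using assms(2) by (simp add: Int_absorb1)
  ultimately show ?thesis using assms(3) by (simp add: infinite_discrete_closed_in_def)
qed

text \<open>\<open>A\<close> is the union of compact closures \<open>K n\<close> in disjoint strips
  of one function \<open>f\<close>. Local finiteness makes it closed, hence the closure of an open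
  set; each \<open>K n\<close> is second countable and open in \<open>A\<close>, which gives
  metrizability. \<open>S\<close> consists of the selected points \<open>t n\<close>.\<close>

lemma discrete_closed_set_in_metrizable_regular_closed_set:
  assumes X: "locally_compact_space X" "Hausdorff_space X" "normal_space X" "locally_metrizable_space X"
    and T: "infinite_discrete_closed_in X T"
  shows "\<exists>A S. regular_closed_in X A \<and> sigma_compact_in X A \<and> metrizable_space (subtopology X A) \<and>
           S \<subseteq> X interior_of A \<and> S \<subseteq> T \<and> infinite_discrete_closed_in X S"
proof -
  have T': "closedin X T" "infinite T" "subtopology X T = discrete_topology T"
    using T by (auto simp: infinite_discrete_closed_in_def)
  obtain t :: "nat \<Rightarrow> 'a" and f where t: "inj t" "range t \<subseteq> T"
    "continuous_map X euclideanreal f" "\<forall>n. f (t n) = real n"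
    using closed_discrete_real_function[OF X(3) T'] by blast
  have "t n \<in> topspace X" for n using t(2) closedin_subset[OF T'(1)] by blast
  then have "\<forall>n. \<exists>N. openin X N \<and> t n \<in> N \<and> metrizable_space (subtopology X N)"
    using X(4) unfolding locally_metrizable_space_def by blast
  then obtain N where N: "\<And>n. openin X (N n)" "\<And>n. t n \<in> N n" "\<And>n. metrizable_space (subtopology X (N n))"
    by metis
  have f': "continuous_map (subtopology X (topspace X)) euclideanreal f" using t(3) by simp
  obtain V :: "nat \<Rightarrow> 'a set" where V: "\<forall>n. openin X (V n) \<and> t n \<in> V n \<and> compactin X (X closure_of V n) \<and>
     X closure_of V n \<subseteq> N n \<and> f ` (X closure_of V n) \<subseteq> {real n - 1/3 <..< real n + 1/3}"
    using separated_compact_neighbourhoods[OF X(1,2) subset_refl f' N(1) openin_subset[OF N(1)] N(2)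
        t(4)[rule_format]] ..
  define K where "K n = X closure_of V n" for n
  have K: "\<And>n. compactin X (K n)" "\<And>n. K n \<subseteq> N n" "\<And>n. f ` K n \<subseteq> {real n - 1/3 <..< real n + 1/3}"
    "\<And>n. K n \<subseteq> topspace X"
    using V by (auto simp: K_def closure_of_subset_topspace)
  have VK: "V n \<subseteq> K n" for n
    unfolding K_def by (rule closure_of_subset[OF openin_subset]) (use V in blast)
  have fin: "finite {n. K n \<inter> C \<noteq> {}}" if "compactin X C" for C
    by (rule compact_meets_finitely_many[OF closedin_topspace f' K(4,3) that])
  define A where "A = (\<Union>n. K n)"
  \<comment> \<open>A compact neighbourhood of a point off \<open>A\<close> meets only finitely many
    \<open>K n\<close>, and their union is closed, so it can be removed.\<close>
  have "openin X (topspace X - A)"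
  proof (subst openin_subopen, intro ballI)
    fix x assume x: "x \<in> topspace X - A"
    then obtain U C where U: "openin X U" "compactin X C" "x \<in> U" "U \<subseteq> C"
      using X(1) unfolding locally_compact_space_def by blast
    let ?L = "\<Union>(K ` {n. K n \<inter> C \<noteq> {}})"
    have "closedin X ?L"
      using fin[OF U(2)] by (intro closedin_Union) (auto simp: K_def)
    then have "openin X (U - ?L)" using U(1) by blast
    moreover have "x \<in> U - ?L" using x U(3) by (auto simp: A_def)
    moreover have "U - ?L \<subseteq> topspace X - A"
      using openin_subset[OF U(1)] U(4) unfolding A_def by blast
    ultimately show "\<exists>W. openin X W \<and> x \<in> W \<and> W \<subseteq> topspace X - A" by (intro exI conjI)
  qed
  then have Ac: "closedin X A" using K(4) by (auto simp: closedin_def A_def)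
  have oV: "openin X (\<Union>n. V n)" using V by blast
  have "A = X closure_of (\<Union>n. V n)"
  proof (rule subset_antisym)
    show "A \<subseteq> X closure_of (\<Union>n. V n)"
      unfolding A_def K_def by (intro UN_least closure_of_mono) blast
    show "X closure_of (\<Union>n. V n) \<subseteq> A"
      using Ac VK by (intro closure_of_minimal) (auto simp: A_def)
  qed
  then have reg: "regular_closed_in X A" using oV regular_closed_in_closure_of_open by metis
  have sig: "sigma_compact_in X A" unfolding sigma_compact_in_def using K(1) A_def by blast
  let ?Y = "subtopology X A"
  have tY: "topspace ?Y = A" using K(4) by (auto simp: A_def)
  \<comment> \<open>The strip around n meets \<open>A\<close> in \<open>K n\<close> alone, because
    values in two strips around different integers cannot coincide.\<close>
  have oK: "openin ?Y (K n)" for n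
  proof -
    have "openin X {x \<in> topspace X. f x \<in> {real n - 1/3 <..< real n + 1/3}}"
      using t(3) by (rule openin_continuous_map_preimage) simp
    moreover have "K n = {x \<in> topspace X. f x \<in> {real n - 1/3 <..< real n + 1/3}} \<inter> A"
    proof (rule subset_antisym)
      show "K n \<subseteq> {x \<in> topspace X. f x \<in> {real n - 1/3 <..< real n + 1/3}} \<inter> A"
        using K(3,4) by (force simp: A_def)
      show "{x \<in> topspace X. f x \<in> {real n - 1/3 <..< real n + 1/3}} \<inter> A \<subseteq> K n"
      proof
        fix x assume x: "x \<in> {x \<in> topspace X. f x \<in> {real n - 1/3 <..< real n + 1/3}} \<inter> A"
        then obtain m where m: "x \<in> K m" by (auto simp: A_def)
        then have "f x \<in> {real m - 1/3 <..< real m + 1/3}" using K(3) by blast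
        then have "\<bar>real m - real n\<bar> < 1" using x by auto
        then have "m = n" by linarith
        then show "x \<in> K n" using m by simp
      qed
    qed
    ultimately show ?thesis using openin_subtopology by blast
  qed
  have "second_countable ?Y"
  proof (rule second_countable_open_cover[of "range K"])
    show "topspace ?Y \<subseteq> \<Union>(range K)" using tY by (simp add: A_def)
    fix U assume "U \<in> range K"
    then obtain n where n: "U = K n" by blast
    show "openin ?Y U" using oK n by simp
    have "subtopology ?Y (K n) = subtopology X (K n)"
      by (simp add: subtopology_subtopology Int_absorb1 A_def UN_upper)
    then show "second_countable (subtopology ?Y U)"
      using compact_subset_of_metrizable_second_countable[OF K(1,2) N(3)] n by simp
  qed simp
  then have met: "metrizable_space ?Y"
    using normal_space_closed_subtopology[OF X(3) Ac] Hausdorff_space_subtopology[OF X(2)]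
    by (rule Urysohn_metrization)
  have "(\<Union>n. V n) \<subseteq> A" using VK by (auto simp: A_def)
  then have "(\<Union>n. V n) \<subseteq> X interior_of A" using oV by (simp add: interior_of_maximal)
  then have "range t \<subseteq> X interior_of A" using V by blast
  moreover have "infinite (range t)" using t(1) by (simp add: finite_image_iff)
  ultimately show ?thesis
    using infinite_discrete_closed_in_subset[OF T t(2)] t(2) reg sig met by blast
qed

text \<open>By the Bolzano-Weierstrass characterisation, non-compactness yields an infinite set
  without limit points; such a set is closed and discrete.\<close>

lemma metrizable_noncompact_imp_infinite_discrete_closed:
  assumes "metrizable_space X" "\<not> compact_space X"
  shows "\<exists>T. infinite_discrete_closed_in X T"
proof -
  obtain M d where "Metric_space M d" and X: "X = Metric_space.mtopology M d"
    using assms(1) by (auto simp: metrizable_space_def)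
  then interpret Metric_space M d by simp
  obtain S where "S \<subseteq> M" "infinite S" "mtopology derived_set_of S = {}"
    using assms(2) X compact_space_eq_Bolzano_Weierstrass by auto
  then have "infinite_discrete_closed_in X S"
    by (simp add: infinite_discrete_closed_in_def X closedin_contains_derived_set
        subtopology_eq_discrete_topology_eq)
  then show ?thesis by blast
qed

text \<open>Discreteness would pass to the subgroup belonging to the closure of an open
  \<open>W \<subseteq> V\<close>, and a discrete group is locally compact.\<close>

lemma Homeo_top_not_discrete_if_no_locally_compact:
  assumes nlc: "\<And>U. openin X U \<Longrightarrow> U \<noteq> {} \<Longrightarrow> compactin X (X closure_of U) \<Longrightarrow>
                  \<not> locally_compact_space (Homeo_top X (X closure_of U))"
    and V: "neighbourhood_of X V t" "compactin X (X closure_of V)"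
  shows "Homeo_top X (X closure_of V) \<noteq> discrete_topology (Homeo X (X closure_of V))"
proof
  assume disc: "Homeo_top X (X closure_of V) = discrete_topology (Homeo X (X closure_of V))"
  obtain W where W: "openin X W" "t \<in> W" "W \<subseteq> V" using V(1) by (auto simp: neighbourhood_of_def)
  have cl: "X closure_of W \<subseteq> X closure_of V" using W(3) by (rule closure_of_mono)
  then have "compactin X (X closure_of W)" using V(2) by (meson closed_compactin closedin_closure_of)
  then have "\<not> locally_compact_space (Homeo_top X (X closure_of W))" using nlc W by blast
  moreover have "Homeo_top X (X closure_of W) = discrete_topology (Homeo X (X closure_of W))"
    unfolding Homeo_top_mono[OF cl] disc using Homeo_mono[OF cl] by (simp add: Int_absorb1)
  ultimately show False by (simp add: locally_compact_space_discrete_topology)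
qed

section \<open>Locally Euclidean spaces\<close>

text \<open>For a subbasic condition on \<open>C\<close> and \<open>U\<close>, either
  \<open>x0\<close> lies in \<open>U\<close> and \<open>N = U\<close> works, or \<open>x0\<close>
  lies off the closed set \<open>C\<close> and supports disjoint from \<open>C\<close> work.\<close>

lemma Homeo_small_support_nhds:
  assumes T2: "Hausdorff_space X" and x0: "x0 \<in> topspace X"
    and W: "openin (maps_compact_open X) W" "id \<in> W"
  shows "\<exists>N. openin X N \<and> x0 \<in> N \<and> (\<forall>h. (\<forall>x. x \<notin> N \<longrightarrow> h x = x) \<and> (\<forall>x\<in>N. h x \<in> N) \<longrightarrow> h \<in> W)"
proof (rule maps_compact_open_nhds_induct[OF W])
  fix C U assume CU: "compactin X C" "openin X U" "id ` C \<subseteq> U"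
  show "\<exists>N. openin X N \<and> x0 \<in> N \<and>
      (\<forall>h. (\<forall>x. x \<notin> N \<longrightarrow> h x = x) \<and> (\<forall>x\<in>N. h x \<in> N) \<longrightarrow> h \<in> {g. g ` C \<subseteq> U})"
  proof (cases "x0 \<in> U")
    case True
    then show ?thesis using CU by (intro exI[of _ U]) auto
  next
    case False
    have "closedin X C" using T2 CU(1) by (rule compactin_imp_closedin)
    then have "openin X (topspace X - C)" by blast
    moreover have "x0 \<in> topspace X - C" using False CU(3) x0 by auto
    moreover have "h ` C \<subseteq> U" if h: "\<forall>x. x \<notin> topspace X - C \<longrightarrow> h x = x" for h
    proof (rule image_subsetI)
      fix c assume c: "c \<in> C"
      then have "h c = c" using h by blast
      then show "h c \<in> U" using c CU(3) by auto
    qed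
    ultimately show ?thesis by (intro exI[of _ "topspace X - C"]) auto
  qed
next
  fix A B
  assume "\<exists>N. openin X N \<and> x0 \<in> N \<and> (\<forall>h. (\<forall>x. x \<notin> N \<longrightarrow> h x = x) \<and> (\<forall>x\<in>N. h x \<in> N) \<longrightarrow> h \<in> A)"
    and "\<exists>N. openin X N \<and> x0 \<in> N \<and> (\<forall>h. (\<forall>x. x \<notin> N \<longrightarrow> h x = x) \<and> (\<forall>x\<in>N. h x \<in> N) \<longrightarrow> h \<in> B)"
  then obtain N N' where N: "openin X N" "x0 \<in> N" "\<And>h. (\<forall>x. x \<notin> N \<longrightarrow> h x = x) \<and> (\<forall>x\<in>N. h x \<in> N) \<longrightarrow> h \<in> A"
    and N': "openin X N'" "x0 \<in> N'" "\<And>h. (\<forall>x. x \<notin> N' \<longrightarrow> h x = x) \<and> (\<forall>x\<in>N'. h x \<in> N') \<longrightarrow> h \<in> B"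
    by metis
  \<comment> \<open>Points of \<open>N\<close> outside \<open>N'\<close> are fixed, so a map
    supported in the intersection and preserving it preserves both sets.\<close>
  have "h \<in> A \<inter> B" if h: "\<forall>x. x \<notin> N \<inter> N' \<longrightarrow> h x = x" "\<forall>x\<in>N \<inter> N'. h x \<in> N \<inter> N'" for h
  proof
    have "h x \<in> N" if "x \<in> N" for x using h that by (cases "x \<in> N'") auto
    then show "h \<in> A" using N(3)[of h] h(1) by blast
    have "h x \<in> N'" if "x \<in> N'" for x using h that by (cases "x \<in> N") auto
    then show "h \<in> B" using N'(3)[of h] h(1) by blast
  qed
  then show "\<exists>N. openin X N \<and> x0 \<in> N \<and> (\<forall>h. (\<forall>x. x \<notin> N \<longrightarrow> h x = x) \<and> (\<forall>x\<in>N. h x \<in> N) \<longrightarrow> h \<in> A \<inter> B)"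
    using N(1,2) N'(1,2) by (intro exI[of _ "N \<inter> N'"] conjI openin_Int) auto
qed (meson subsetD)

text \<open>\<open>D\<close> and the complement of \<open>V\<close> form a closed cover, and
  \<open>h\<close> is the identity on the second part. Preimages and images of closed sets are
  therefore unions of two closed sets; compactness of \<open>D\<close> makes the image of the first
  part closed.\<close>

lemma homeomorphic_map_extend_by_id:
  assumes T2: "Hausdorff_space X" and D: "compactin X D" and V: "openin X V" "V \<subseteq> D"
    and h: "continuous_map (subtopology X D) X h" "bij_betw h D D" "\<And>x. x \<notin> V \<Longrightarrow> h x = x"
  shows "homeomorphic_map X X h"
proof (rule bijective_closed_imp_homeomorphic_map)
  have Dt: "D \<subseteq> topspace X" using D by (rule compactin_subset_topspace)
  have Dc: "closedin X D" using T2 D by (rule compactin_imp_closedin)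
  have off: "bij_betw h (topspace X - D) (topspace X - D)"
  proof -
    have "h x = id x" if "x \<in> topspace X - D" for x using that h(3) V(2) by auto
    then have "bij_betw h (topspace X - D) (topspace X - D) = bij_betw id (topspace X - D) (topspace X - D)"
      by (rule bij_betw_cong)
    then show ?thesis by simp
  qed
  have "bij_betw h (D \<union> (topspace X - D)) (D \<union> (topspace X - D))"
    using h(2) off by (rule bij_betw_combine) blast
  then have bij: "bij_betw h (topspace X) (topspace X)" using Dt by (simp add: Un_absorb1)
  then show im: "h ` topspace X = topspace X" and "inj_on h (topspace X)" by (auto simp: bij_betw_def)
  show "continuous_map X X h"
    unfolding continuous_map_closedin
  proof (intro conjI allI impI)
    show "h \<in> topspace X \<rightarrow> topspace X" using im by blast
    fix C assume C: "closedin X C"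
    have "closedin (subtopology X D) {x \<in> topspace (subtopology X D). h x \<in> C}"
      using h(1) C by (rule closedin_continuous_map_preimage)
    then have "closedin X {x \<in> topspace (subtopology X D). h x \<in> C}"
      using Dc by (rule closedin_trans_full)
    moreover have "closedin X (C - V)" using C V(1) by (rule closedin_diff)
    moreover have "{x \<in> topspace X. h x \<in> C} = {x \<in> topspace (subtopology X D). h x \<in> C} \<union> (C - V)"
      using h(3) V(2) Dt closedin_subset[OF C] by (auto; metis subsetD)
    ultimately show "closedin X {x \<in> topspace X. h x \<in> C}" by (metis closedin_Un)
  qed
  show "closed_map X X h"
    unfolding closed_map_def
  proof (intro allI impI)
    fix C assume C: "closedin X C"
    have "compactin X (D \<inter> C)" using D C by (rule compact_Int_closedin)
    then have "compactin (subtopology X D) (D \<inter> C)" by (simp add: compactin_subtopology)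
    then have "compactin X (h ` (D \<inter> C))" using h(1) by (rule image_compactin)
    then have "closedin X (h ` (D \<inter> C))" using T2 compactin_imp_closedin by blast
    moreover have "closedin X (C - V)" using C V(1) by (rule closedin_diff)
    moreover have "h ` C = h ` (D \<inter> C) \<union> (C - V)"
    proof -
      have "C = (D \<inter> C) \<union> (C - V)" using V(2) by blast
      moreover have "h ` (C - V) = C - V" using h(3) by (auto simp: image_iff)
      ultimately show ?thesis by (metis image_Un)
    qed
    ultimately show "closedin X (h ` C)" by (metis closedin_Un)
  qed
qed

text \<open>Otherwise finitely many open sets, each visited for finitely many indices only, would
  cover \<open>Q\<close> and exhaust all natural numbers.\<close>

lemma compactin_sequence_cluster_point:
  fixes h :: "nat \<Rightarrow> 'b"
  assumes Q: "compactin Y Q" and h: "\<And>k. h k \<in> Q"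
  shows "\<exists>z\<in>Q. \<forall>U. openin Y U \<and> z \<in> U \<longrightarrow> infinite {k. h k \<in> U}"
proof (rule ccontr)
  assume "\<not> ?thesis"
  then have "\<forall>z\<in>Q. \<exists>U. openin Y U \<and> z \<in> U \<and> finite {k. h k \<in> U}" by blast
  then obtain U where U: "\<And>z. z \<in> Q \<Longrightarrow> openin Y (U z) \<and> z \<in> U z \<and> finite {k. h k \<in> U z}"
    by metis
  have "\<exists>\<U>. finite \<U> \<and> \<U> \<subseteq> U ` Q \<and> Q \<subseteq> \<Union>\<U>"
    by (rule compactinD[OF Q]) (use U in auto)
  then obtain F where F: "finite F" "F \<subseteq> Q" "Q \<subseteq> \<Union>(U ` F)"
    by (metis finite_subset_image)
  have "UNIV = (\<Union>z\<in>F. {k. h k \<in> U z})" using F(3) h by blast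
  moreover have "finite (\<Union>z\<in>F. {k. h k \<in> U z})" using F U by (intro finite_UN_I) auto
  ultimately show False using infinite_UNIV_nat by metis
qed

text \<open>A finite coordinate sum is continuous on the full product, dominates each coordinate and
  scales exactly along rays. On \<open>Euclidean_space n\<close>, where later coordinates vanish, it
  is the usual l1 metric.\<close>

definition l1_dist :: "nat \<Rightarrow> (nat \<Rightarrow> real) \<Rightarrow> (nat \<Rightarrow> real) \<Rightarrow> real" where
  "l1_dist n p q = (\<Sum>i<n. \<bar>p i - q i\<bar>)"

lemma l1_dist_nonneg [simp]: "l1_dist n p q \<ge> 0"
  by (simp add: l1_dist_def sum_nonneg)

lemma l1_dist_coordinate: "i < n \<Longrightarrow> \<bar>p i - q i\<bar> \<le> l1_dist n p q"
  unfolding l1_dist_def by (rule member_le_sum) auto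

lemma l1_dist_eq_0:
  assumes "p \<in> topspace (Euclidean_space n)" "q \<in> topspace (Euclidean_space n)" "l1_dist n p q = 0"
  shows "p = q"
proof
  fix i show "p i = q i"
  proof (cases "i < n")
    case True then show ?thesis using l1_dist_coordinate[of i n p q] assms(3) by auto
  next
    case False then show ?thesis using assms by (simp add: topspace_Euclidean_space)
  qed
qed

lemma continuous_map_l1_dist:
  "continuous_map (powertop_real UNIV) euclideanreal (\<lambda>p. l1_dist n p q)"
  unfolding l1_dist_def
  by (intro continuous_intros) auto

lemma continuous_map_Euclidean_l1_dist:
  "continuous_map (Euclidean_space n) euclideanreal (\<lambda>p. l1_dist n p q)"
  unfolding Euclidean_space_def by (intro continuous_map_from_subtopology continuous_map_l1_dist)

lemma Euclidean_space_open_contains_l1_ball: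
  assumes S: "openin (Euclidean_space n) S" and p0: "p0 \<in> S"
  shows "\<exists>\<epsilon>>0. {p \<in> topspace (Euclidean_space n). l1_dist n p p0 \<le> \<epsilon>} \<subseteq> S"
proof -
  obtain T where T: "openin (powertop_real UNIV) T" "S = T \<inter> {x. \<forall>i\<ge>n. x i = 0}"
    using S by (auto simp: Euclidean_space_def openin_subtopology)
  obtain B where B: "p0 \<in> Pi\<^sub>E UNIV B" "\<And>i. open (B i)" "Pi\<^sub>E UNIV B \<subseteq> T"
    using product_topology_open_contains_basis[OF T(1), of p0] p0 T(2) by auto
  have "\<forall>i. \<exists>e>0. ball (p0 i) e \<subseteq> B i"
    using B(1,2) by (meson PiE_E UNIV_I open_contains_ball)
  then obtain e where e: "\<And>i. e i > 0" "\<And>i. ball (p0 i) (e i) \<subseteq> B i" by metis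
  \<comment> \<open>The entry 1 keeps the minimum defined for \<open>n = 0\<close>. Halving turns
    the non-strict ball condition into the strict bounds required by the open intervals.\<close>
  define \<epsilon> where "\<epsilon> = Min (insert 1 (e ` {..<n})) / 2"
  have m: "Min (insert 1 (e ` {..<n})) > 0" using e(1) by (subst Min_gr_iff) auto
  have lt: "\<epsilon> < e i" if "i < n" for i
  proof -
    have "Min (insert 1 (e ` {..<n})) \<le> e i" using that by (intro Min_le) auto
    then show ?thesis using m unfolding \<epsilon>_def by linarith
  qed
  have "{p \<in> topspace (Euclidean_space n). l1_dist n p p0 \<le> \<epsilon>} \<subseteq> S"
  proof
    fix p assume p: "p \<in> {p \<in> topspace (Euclidean_space n). l1_dist n p p0 \<le> \<epsilon>}"
    have "p i \<in> B i" for i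
    proof (cases "i < n")
      case True
      then have "p i \<in> ball (p0 i) (e i)"
        using l1_dist_coordinate[OF True, of p p0] p lt[OF True] by (simp add: dist_real_def abs_minus_commute)
      then show ?thesis using e(2) by blast
    next
      case False
      then have "p i = p0 i" using p p0 T(2) by (simp add: topspace_Euclidean_space)
      then show ?thesis using B(1) by auto
    qed
    then have "p \<in> T" using B(3) by auto
    then show "p \<in> S" using p T(2) by (simp add: topspace_Euclidean_space)
  qed
  then show ?thesis using m by (intro exI[of _ \<epsilon>]) (simp add: \<epsilon>_def)
qed

text \<open>The ball is closed in the full product and contained in a product of compact intervals,
  which is compact by Tychonoff.\<close>

lemma compactin_l1_ball:
  assumes p0: "p0 \<in> topspace (Euclidean_space n)"
  shows "compactin (Euclidean_space n) {p \<in> topspace (Euclidean_space n). l1_dist n p p0 \<le> \<epsilon>}"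
proof -
  let ?D = "{p \<in> topspace (Euclidean_space n). l1_dist n p p0 \<le> \<epsilon>}"
  let ?Box = "Pi\<^sub>E UNIV (\<lambda>i. {p0 i - \<epsilon>..p0 i + \<epsilon>})"
  have "compactin (powertop_real UNIV) ?Box" by (simp add: compactin_PiE)
  moreover have "?D \<subseteq> ?Box"
  proof
    fix p assume p: "p \<in> ?D"
    have "\<bar>p i - p0 i\<bar> \<le> \<epsilon>" for i
    proof (cases "i < n")
      case True then show ?thesis using l1_dist_coordinate[OF True, of p p0] p by simp
    next
      case False
      then have "p i = p0 i" using p p0 by (simp add: topspace_Euclidean_space)
      \<comment> \<open>The sign of \<open>\<epsilon>\<close> is not assumed; it follows from the
        ball having a point.\<close>
      moreover have "0 \<le> \<epsilon>" using p l1_dist_nonneg[of n p p0] order_trans by blast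
      ultimately show ?thesis by simp
    qed
    then show "p \<in> ?Box" by (auto simp: abs_le_iff) (smt (verit))+
  qed
  moreover have "closedin (powertop_real UNIV) ?D"
  proof -
    have "closedin (powertop_real UNIV) {p \<in> topspace (powertop_real UNIV). l1_dist n p p0 \<in> {..\<epsilon>}}"
      by (rule closedin_continuous_map_preimage[OF continuous_map_l1_dist]) simp
    moreover have "?D = topspace (Euclidean_space n) \<inter> {p \<in> topspace (powertop_real UNIV). l1_dist n p p0 \<in> {..\<epsilon>}}"
      by auto
    ultimately show ?thesis using closedin_Int[OF closedin_Euclidean_space[of n]] by (simp only:)
  qed
  ultimately have "compactin (powertop_real UNIV) ?D" by (rule closed_compactin)
  then show ?thesis
    unfolding Euclidean_space_def compactin_subtopology by auto
qed

text \<open>In normalised form this is p |-> |p|^k p. The centre and the sphere of radius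
  \<open>\<epsilon>\<close> stay fixed, while every point strictly inside tends to the centre as
  \<open>k\<close> grows.\<close>

definition radial_contraction :: "nat \<Rightarrow> (nat \<Rightarrow> real) \<Rightarrow> real \<Rightarrow> nat \<Rightarrow> (nat \<Rightarrow> real) \<Rightarrow> nat \<Rightarrow> real" where
  "radial_contraction n p0 \<epsilon> k p = (\<lambda>i. p0 i + (l1_dist n p p0 / \<epsilon>) ^ k * (p i - p0 i))"

lemma l1_dist_scale: "c \<ge> 0 \<Longrightarrow> l1_dist n (\<lambda>i. p0 i + c * (p i - p0 i)) p0 = c * l1_dist n p p0"
  by (simp add: l1_dist_def abs_mult sum_distrib_left)

lemma l1_dist_radial_contraction:
  "\<epsilon> > 0 \<Longrightarrow> l1_dist n (radial_contraction n p0 \<epsilon> k p) p0 = (l1_dist n p p0 / \<epsilon>) ^ k * l1_dist n p p0"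
  unfolding radial_contraction_def by (rule l1_dist_scale) simp

lemma continuous_map_radial_contraction:
  assumes "p0 \<in> topspace (Euclidean_space n)" "\<epsilon> > 0"
  shows "continuous_map (Euclidean_space n) (Euclidean_space n) (radial_contraction n p0 \<epsilon> k)"
proof -
  have "continuous_map (powertop_real UNIV) euclideanreal (\<lambda>p. radial_contraction n p0 \<epsilon> k p i)" for i
    unfolding radial_contraction_def using assms(2)
    by (intro continuous_intros continuous_map_l1_dist) auto
  then have "continuous_map (powertop_real UNIV) (powertop_real UNIV) (radial_contraction n p0 \<epsilon> k)"
    by (simp add: continuous_map_componentwise_UNIV)
  then show ?thesis
    using assms(1) unfolding Euclidean_space_def continuous_map_in_subtopology
    by (auto simp: continuous_map_from_subtopology radial_contraction_def)
qed

text \<open>Each ray is preserved, and the normalised distance changes by s |-> s^(k+1), a bijection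
  of the unit interval. The centre is treated separately because the direction of the ray is
  undefined there.\<close>

lemma bij_betw_radial_contraction:
  assumes p0: "p0 \<in> topspace (Euclidean_space n)" and \<epsilon>: "\<epsilon> > 0"
  shows "bij_betw (radial_contraction n p0 \<epsilon> k) {p \<in> topspace (Euclidean_space n). l1_dist n p p0 \<le> \<epsilon>}
           {p \<in> topspace (Euclidean_space n). l1_dist n p p0 \<le> \<epsilon>}" (is "bij_betw ?g ?D ?D")
  unfolding bij_betw_def
proof
  let ?s = "\<lambda>p. l1_dist n p p0 / \<epsilon>"
  have s: "0 \<le> ?s p" "p \<in> ?D \<Longrightarrow> ?s p \<le> 1" for p using \<epsilon> by auto
  have gs: "?s (?g p) = ?s p ^ Suc k" for p using l1_dist_radial_contraction[OF \<epsilon>] by simp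
  show "inj_on ?g ?D"
  proof (rule inj_onI)
    fix p q assume pq: "p \<in> ?D" "q \<in> ?D" "?g p = ?g q"
    then have "?s p ^ Suc k = ?s q ^ Suc k" using gs by metis
    then have seq: "?s p = ?s q" using s(1) by (metis power_eq_imp_eq_base zero_less_Suc)
    show "p = q"
    proof (cases "?s p = 0")
      case True
      then have "p = p0" "q = p0" using seq \<epsilon> pq l1_dist_eq_0[OF _ p0] by auto
      then show ?thesis by simp
    next
      case False
      have "?s p ^ k * (p i - p0 i) = ?s p ^ k * (q i - p0 i)" for i
        using fun_cong[OF pq(3), of i] unfolding radial_contraction_def seq by (simp only: add_left_cancel)
      then have "p i = q i" for i using False by auto
      then show ?thesis by auto
    qed
  qed
  show "?g ` ?D = ?D"
  proof (rule subset_antisym)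
    show "?g ` ?D \<subseteq> ?D"
    proof (rule image_subsetI)
      fix p assume p: "p \<in> ?D"
      have "?g p \<in> topspace (Euclidean_space n)"
        using p p0 by (simp add: topspace_Euclidean_space radial_contraction_def)
      moreover have "?s (?g p) \<le> 1" unfolding gs using s[of p] p by (intro power_le_one) auto
      ultimately show "?g p \<in> ?D" using \<epsilon> by simp
    qed
    show "?D \<subseteq> ?g ` ?D"
    proof
      fix q assume q: "q \<in> ?D"
      show "q \<in> ?g ` ?D"
      proof (cases "?s q = 0")
        case True
        then have "q = p0" using \<epsilon> q l1_dist_eq_0[OF _ p0] by auto
        then have "?g q = q" by (simp add: radial_contraction_def)
        then show ?thesis using q by (metis imageI)
      next
        case False
        \<comment> \<open>\<open>r\<close> is the normalised distance of the preimage sought.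
          Dividing the displacement of \<open>q\<close> by \<open>r ^ k\<close> gives a point at
          distance \<open>\<epsilon> * r\<close>, at which the scaling factor is exactly
          \<open>r ^ k\<close>.\<close>
        define r where "r = root (Suc k) (?s q)"
        have r: "r > 0" "r \<le> 1" "r ^ Suc k = ?s q"
        proof -
          show "r > 0" "r \<le> 1" using False s[of q] q by (auto simp: r_def less_le)
          show "r ^ Suc k = ?s q" unfolding r_def using s(1) by (intro real_root_pow_pos2) auto
        qed
        define p where "p = (\<lambda>i. p0 i + (1 / r ^ k) * (q i - p0 i))"
        have "l1_dist n p p0 = (1 / r ^ k) * l1_dist n q p0"
          unfolding p_def using r by (intro l1_dist_scale) simp
        also have "\<dots> = (1 / r ^ k) * (\<epsilon> * r ^ Suc k)" using r(3) \<epsilon> by simp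
        also have "\<dots> = \<epsilon> * r" using r(1) by simp
        finally have lp: "l1_dist n p p0 = \<epsilon> * r" .
        then have "p \<in> ?D"
          using q p0 r \<epsilon> by (auto simp: topspace_Euclidean_space p_def)
        moreover have "?g p = q"
          unfolding radial_contraction_def lp using \<epsilon> r(1) by (auto simp: p_def)
        ultimately show ?thesis by blast
      qed
    qed
  qed
qed

text \<open>All radial maps of a small chart ball lie in one compact neighbourhood \<open>Q\<close>
  of the identity, so they would have a cluster point in \<open>Q\<close>. It would send the centre
  and an inner point of the ball to the same point, although members of \<open>Q\<close> are
  injective.\<close>

lemma locally_euclidean_imp_Homeo_top_not_locally_compact:
  assumes T2: "Hausdorff_space X" and le: "locally_euclidean_space X" and ni: "no_isolated_points X"
    and U: "openin X U" "U \<noteq> {}"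
  shows "\<not> locally_compact_space (Homeo_top X (X closure_of U))"
proof
  let ?K = "X closure_of U"
  assume lc: "locally_compact_space (Homeo_top X ?K)"
  obtain x0 where x0: "x0 \<in> U" using U(2) by blast
  have x0t: "x0 \<in> topspace X" using x0 openin_subset[OF U(1)] by blast
  obtain W Q where W: "openin (Homeo_top X ?K) W" "compactin (Homeo_top X ?K) Q" "id \<in> W" "W \<subseteq> Q"
    using lc unfolding locally_compact_space_def topspace_Homeo_top using id_in_Homeo[of X ?K] by blast
  obtain W' where W': "openin (maps_compact_open X) W'" "W = W' \<inter> Homeo X ?K"
    using W(1) by (auto simp: openin_Homeo_top)
  obtain N where N: "openin X N" "x0 \<in> N"
    "\<forall>h. (\<forall>x. x \<notin> N \<longrightarrow> h x = x) \<and> (\<forall>x\<in>N. h x \<in> N) \<longrightarrow> h \<in> W'"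
    using Homeo_small_support_nhds[OF T2 x0t W'(1)] W(3) W'(2) by blast
  obtain O1 n where O1: "openin X O1" "x0 \<in> O1" "subtopology X O1 homeomorphic_space Euclidean_space n"
    using le x0t unfolding locally_euclidean_space_def by blast
  let ?E = "Euclidean_space n"
  obtain \<phi> \<psi> where "homeomorphic_maps (subtopology X O1) ?E \<phi> \<psi>"
    using O1(3) unfolding homeomorphic_space_def by blast
  then have \<phi>: "continuous_map (subtopology X O1) ?E \<phi>" and \<psi>: "continuous_map ?E (subtopology X O1) \<psi>"
    and \<psi>\<phi>: "\<And>x. x \<in> O1 \<Longrightarrow> \<psi> (\<phi> x) = x" and \<phi>\<psi>: "\<And>p. p \<in> topspace ?E \<Longrightarrow> \<phi> (\<psi> p) = p"
    using openin_subset[OF O1(1)] by (auto simp: homeomorphic_maps_def)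
  have tO: "topspace (subtopology X O1) = O1" using openin_subset[OF O1(1)] by auto
  have \<phi>E: "\<phi> x \<in> topspace ?E" if "x \<in> O1" for x using \<phi> that tO by (auto simp: continuous_map_def)
  have \<psi>O: "\<psi> p \<in> O1" if "p \<in> topspace ?E" for p using \<psi> that tO by (auto simp: continuous_map_def)
  have \<psi>X: "continuous_map ?E X \<psi>" using \<psi> by (simp add: continuous_map_in_subtopology)
  have pre: "openin ?E {p \<in> topspace ?E. \<psi> p \<in> A}" if "openin X A" for A
    using \<psi>X that by (rule openin_continuous_map_preimage)
  define p0 where "p0 = \<phi> x0"
  have p0: "p0 \<in> topspace ?E" "\<psi> p0 = x0" using O1(2) \<phi>E \<psi>\<phi> by (auto simp: p0_def)
  \<comment> \<open>A chart of dimension 0 would be a single open point, hence an isolated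
    one.\<close>
  have n: "n > 0"
  proof (rule ccontr)
    assume "\<not> n > 0"
    then have "topspace ?E = {\<lambda>i. 0}" by (auto simp: topspace_Euclidean_space)
    then have "O1 \<subseteq> {\<psi> (\<lambda>i. 0)}" using \<phi>E \<psi>\<phi> by fastforce
    then have "O1 = {x0}" using O1(2) by blast
    then show False using O1(1) ni x0t by (auto simp: no_isolated_points_def)
  qed
  have "openin X (N \<inter> U)" using N(1) U(1) by blast
  \<comment> \<open>The ball lies in \<open>N\<close>, which puts the maps into the given
    neighbourhood, and in \<open>U\<close>, which puts their supports into the closure of
    \<open>U\<close>.\<close>
  then obtain \<epsilon> where \<epsilon>: "\<epsilon> > 0" "{p \<in> topspace ?E. l1_dist n p p0 \<le> \<epsilon>} \<subseteq> {p \<in> topspace ?E. \<psi> p \<in> N \<inter> U}"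
    using Euclidean_space_open_contains_l1_ball[OF pre, of "N \<inter> U" p0] p0 N(2) x0 by auto
  define D where "D = {p \<in> topspace ?E. l1_dist n p p0 \<le> \<epsilon>}"
  define V where "V = {p \<in> topspace ?E. l1_dist n p p0 < \<epsilon>}"
  have VD: "V \<subseteq> D" by (auto simp: V_def D_def)
  have inj\<psi>: "inj_on \<psi> (topspace ?E)" using \<phi>\<psi> by (metis inj_onI)
  have DE: "D \<subseteq> topspace ?E" by (auto simp: D_def)
  have \<psi>D: "\<psi> ` D \<subseteq> O1" "\<psi> ` D \<subseteq> N" "\<psi> ` D \<subseteq> U"
    using \<psi>O \<epsilon>(2) by (auto simp: D_def)
  have cD: "compactin X (\<psi> ` D)"
    unfolding D_def by (rule image_compactin[OF compactin_l1_ball[OF p0(1)] \<psi>X])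
  have oV: "openin X (\<psi> ` V)"
  proof -
    have "openin ?E {p \<in> topspace ?E. l1_dist n p p0 \<in> {..<\<epsilon>}}"
      by (rule openin_continuous_map_preimage[OF continuous_map_Euclidean_l1_dist]) simp
    then have "openin (subtopology X O1) {x \<in> topspace (subtopology X O1). \<phi> x \<in> {p \<in> topspace ?E. l1_dist n p p0 \<in> {..<\<epsilon>}}}"
      using \<phi> by (rule openin_continuous_map_preimage[rotated])
    moreover have "{x \<in> topspace (subtopology X O1). \<phi> x \<in> {p \<in> topspace ?E. l1_dist n p p0 \<in> {..<\<epsilon>}}} = \<psi> ` V"
      unfolding tO V_def using \<psi>\<phi> \<phi>\<psi> \<psi>O \<phi>E by (force simp: image_iff)
    ultimately show ?thesis using O1(1) by (metis openin_trans_full)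
  qed
  define g where "g k = radial_contraction n p0 \<epsilon> k" for k
  have gD: "bij_betw (g k) D D" for k
    unfolding g_def D_def using p0(1) \<epsilon>(1) by (rule bij_betw_radial_contraction)
  have gE: "continuous_map ?E ?E (g k)" for k
    unfolding g_def using p0(1) \<epsilon>(1) by (rule continuous_map_radial_contraction)
  define h where "h k x = (if x \<in> \<psi> ` D then \<psi> (g k (\<phi> x)) else x)" for k x
  have h\<psi>: "h k (\<psi> p) = \<psi> (g k p)" if "p \<in> D" for k p
    using that DE \<phi>\<psi> by (auto simp: h_def)
  have hD: "bij_betw (h k) (\<psi> ` D) (\<psi> ` D)" for k
  proof -
    have b: "bij_betw \<psi> D (\<psi> ` D)" using inj\<psi> DE by (meson inj_on_imp_bij_betw inj_on_subset)
    have c: "bij_betw \<phi> (\<psi> ` D) D"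
      by (rule bij_betw_byWitness[where f' = \<psi>]) (use \<phi>\<psi> DE in auto)
    have "bij_betw (\<psi> \<circ> (g k \<circ> \<phi>)) (\<psi> ` D) (\<psi> ` D)"
      using bij_betw_trans[OF bij_betw_trans[OF c gD] b] .
    moreover have "bij_betw (h k) (\<psi> ` D) (\<psi> ` D) = bij_betw (\<psi> \<circ> (g k \<circ> \<phi>)) (\<psi> ` D) (\<psi> ` D)"
      by (rule bij_betw_cong) (simp add: h_def)
    ultimately show ?thesis by simp
  qed
  \<comment> \<open>On the boundary sphere the normalised distance is 1, so the radial map is the
    identity there and matches the second branch of \<open>h\<close>.\<close>
  have h_off: "h k x = x" if "x \<notin> \<psi> ` V" for k x
  proof (cases "x \<in> \<psi> ` D")
    case True
    then obtain p where p: "p \<in> D" "x = \<psi> p" by blast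
    then have "l1_dist n p p0 = \<epsilon>" using that by (auto simp: V_def D_def)
    then have "g k p = p" using \<epsilon>(1) by (simp add: g_def radial_contraction_def)
    then show ?thesis using h\<psi> p by simp
  qed (simp add: h_def)
  have hc: "continuous_map (subtopology X (\<psi> ` D)) X (h k)" for k
  proof -
    have "continuous_map (subtopology X (\<psi> ` D)) ?E \<phi>"
      using continuous_map_from_subtopology[OF \<phi>, of "\<psi> ` D"] \<psi>D(1)
      by (simp add: subtopology_subtopology Int_absorb1)
    then have "continuous_map (subtopology X (\<psi> ` D)) X (\<psi> \<circ> (g k \<circ> \<phi>))"
      using gE \<psi>X by (intro continuous_map_compose)
    then show ?thesis by (rule continuous_map_eq) (simp add: h_def)
  qed
  have hH: "h k \<in> Homeo X ?K" for k
  proof -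
    have "homeomorphic_map X X (h k)"
      by (rule homeomorphic_map_extend_by_id[OF T2 cD oV _ hc hD h_off]) (use VD in auto)
    moreover have "\<psi> ` V \<subseteq> ?K"
      using \<psi>D(3) VD closure_of_subset[OF openin_subset[OF U(1)]] by blast
    then have "h k x = x" if "x \<notin> ?K" for x using that by (intro h_off) blast
    ultimately show ?thesis by (simp add: Homeo_def)
  qed
  have hQ: "h k \<in> Q" for k
  proof -
    have "h k x \<in> N" if "x \<in> N" for x
    proof (cases "x \<in> \<psi> ` D")
      case True
      then have "h k x \<in> \<psi> ` D" using hD[of k] by (auto simp: bij_betw_def)
      then show ?thesis using \<psi>D by blast
    qed (simp add: h_def that)
    moreover have "h k x = x" if "x \<notin> N" for x
      using that \<psi>D(2) by (auto simp: h_def)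
    ultimately have "h k \<in> W'" using N(3) by blast
    then show ?thesis using hH W'(2) W(4) by blast
  qed
  from compactin_sequence_cluster_point[OF W(2) hQ]
  obtain z where z: "z \<in> Q" "\<forall>A. openin (Homeo_top X ?K) A \<and> z \<in> A \<longrightarrow> infinite {k. h k \<in> A}" ..
  have zH: "z \<in> Homeo X ?K" using z(1) compactin_subset_topspace[OF W(2)] by auto
  \<comment> \<open>Evaluation at one point is continuous and \<open>X\<close> is Hausdorff, so
    where the values of the sequence converge, the cluster point takes the limit.\<close>
  have lim: "z x = l" if x: "x \<in> topspace X" and l: "l \<in> topspace X"
    and conv: "\<And>A. openin X A \<Longrightarrow> l \<in> A \<Longrightarrow> \<exists>M. \<forall>k\<ge>M. h k x \<in> A" for x l
  proof (rule ccontr)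
    assume "z x \<noteq> l"
    moreover have "z x \<in> topspace X" using x Homeo_continuous_map[OF zH] by (auto simp: continuous_map_def)
    ultimately obtain A A' where A: "openin X A" "openin X A'" "z x \<in> A" "l \<in> A'" "disjnt A A'"
      using T2 l by (metis Hausdorff_space_def)
    obtain M where M: "\<forall>k\<ge>M. h k x \<in> A'" using conv A by blast
    have "openin (Homeo_top X ?K) {f \<in> Homeo X ?K. f ` {x} \<subseteq> A}"
      using x A(1) by (intro openin_Homeo_top_subbasic) auto
    then have "infinite {k. h k \<in> {f \<in> Homeo X ?K. f ` {x} \<subseteq> A}}"
      using z(2) zH A(3) by auto
    moreover have "{k. h k \<in> {f \<in> Homeo X ?K. f ` {x} \<subseteq> A}} \<subseteq> {..<M}"
    proof
      fix k assume "k \<in> {k. h k \<in> {f \<in> Homeo X ?K. f ` {x} \<subseteq> A}}"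
      then have "h k x \<in> A" by auto
      then have "\<not> k \<ge> M" using M A(5) by (auto simp: disjnt_iff)
      then show "k \<in> {..<M}" by simp
    qed
    ultimately show False using finite_subset by blast
  qed
  have p0D: "p0 \<in> D" using p0 \<epsilon>(1) by (simp add: D_def l1_dist_def)
  have "h k x0 = x0" for k
    using h\<psi>[OF p0D, of k] p0(2) by (simp add: g_def radial_contraction_def)
  then have z0: "z x0 = x0" using x0t by (intro lim) auto
  \<comment> \<open>The test point lies halfway to the sphere along coordinate 0, which is a genuine
    coordinate because \<open>n > 0\<close>.\<close>
  define q where "q = (\<lambda>i. p0 i + (if i = 0 then \<epsilon> / 2 else 0))"
  have qE: "q \<in> topspace ?E" using p0(1) n by (auto simp: q_def topspace_Euclidean_space)
  have "(\<Sum>i<n. \<bar>if i = 0 then \<epsilon> / 2 else 0\<bar>) = (\<Sum>i<n. if i = 0 then \<epsilon> / 2 else 0)"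
    using \<epsilon>(1) by (intro sum.cong) auto
  then have lq: "l1_dist n q p0 = \<epsilon> / 2"
    using n by (simp add: l1_dist_def q_def)
  have qD: "q \<in> D" using qE lq \<epsilon>(1) by (simp add: D_def)
  have "z (\<psi> q) = x0"
  proof (rule lim)
    show "\<psi> q \<in> topspace X" using \<psi>O[OF qE] openin_subset[OF O1(1)] by blast
    fix A assume A: "openin X A" "x0 \<in> A"
    then obtain \<delta> where \<delta>: "\<delta> > 0" "{p \<in> topspace ?E. l1_dist n p p0 \<le> \<delta>} \<subseteq> {p \<in> topspace ?E. \<psi> p \<in> A}"
      using Euclidean_space_open_contains_l1_ball[OF pre, of A p0] p0 by auto
    obtain M where M: "(1/2::real) ^ M < \<delta> / \<epsilon>"
      using real_arch_pow_inv[of "\<delta> / \<epsilon>" "1/2"] \<delta>(1) \<epsilon>(1) by auto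
    have "h k (\<psi> q) \<in> A" if "k \<ge> M" for k
    proof -
      \<comment> \<open>The normalised distance of \<open>q\<close> is 1/2, so the contraction
        factor is the k-th power of 1/2 and the images converge to the centre.\<close>
      have "l1_dist n (g k q) p0 = (1/2) ^ k * (\<epsilon> / 2)"
        unfolding g_def l1_dist_radial_contraction[OF \<epsilon>(1)] lq using \<epsilon>(1) by simp
      also have "\<dots> \<le> (1/2) ^ M * \<epsilon>"
        using \<epsilon>(1) that by (intro mult_mono power_decreasing) auto
      also have "\<dots> \<le> \<delta>" using M \<epsilon>(1) by (simp add: pos_less_divide_eq)
      finally have "l1_dist n (g k q) p0 \<le> \<delta>" .
      moreover have "g k q \<in> topspace ?E" using gD[of k] qD DE by (auto simp: bij_betw_def)
      ultimately have "\<psi> (g k q) \<in> A" using \<delta>(2) by blast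
      then show ?thesis using h\<psi>[OF qD] by simp
    qed
    then show "\<exists>M. \<forall>k\<ge>M. h k (\<psi> q) \<in> A" by blast
  qed (rule x0t)
  moreover have "inj z"
    using Homeo_bij[OF zH] closure_of_subset_topspace by (metis bij_is_inj)
  ultimately have "\<psi> q = x0" using z0 by (metis injD)
  then have "q = p0" using inj\<psi> qE p0 by (metis inj_onD)
  then have "q 0 = p0 0" by simp
  then show False using \<epsilon>(1) by (simp add: q_def)
qed

section \<open>The chain of implications\<close>

theorem mainTheorem5:
  fixes X :: "'a topology"
  assumes "locally_compact_space X" and "Hausdorff_space X" and "\<not> compact_space X"
  defines "cI \<equiv> metrizable_space X \<and> locally_euclidean_space X \<and> no_isolated_points X"
    and "cII \<equiv> metrizable_space X \<and>
           (\<forall>U. openin X U \<and> U \<noteq> {} \<and> compactin X (X closure_of U) \<longrightarrow>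
                 \<not> locally_compact_space (Homeo_top X (X closure_of U)))"
    and "cIII \<equiv> normal_space X \<and> locally_metrizable_space X \<and>
           (\<exists>M0. compactin X M0 \<and> \<not> locally_compact_space (Homeo_top X M0)) \<and>
           (\<exists>T. infinite_discrete_closed_in X T \<and>
                (\<forall>t\<in>T. \<forall>V. neighbourhood_of X V t \<and> compactin X (X closure_of V) \<longrightarrow>
                   Homeo_top X (X closure_of V) \<noteq> discrete_topology (Homeo X (X closure_of V))))"
    and "cIV \<equiv>
           (\<exists>M0. compactin X M0 \<and> metrizable_space (subtopology X M0) \<and>
                 \<not> locally_compact_space (Homeo_top X M0)) \<and>
           (\<exists>A T. regular_closed_in X A \<and> sigma_compact_in X A \<and>
                  metrizable_space (subtopology X A) \<and>
                  T \<subseteq> X interior_of A \<and> infinite_discrete_closed_in X T \<and>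
                  (\<forall>t\<in>T. \<forall>V. neighbourhood_of X V t \<and> compactin X (X closure_of V) \<longrightarrow>
                     Homeo_top X (X closure_of V) \<noteq> discrete_topology (Homeo X (X closure_of V))))"
    and "cV \<equiv> \<not> Homeo_family_ACP X"
  shows "(cI \<longrightarrow> cII) \<and> (cII \<longrightarrow> cIII) \<and> (cIII \<longrightarrow> cIV) \<and> (cIV \<longrightarrow> cV)"
proof (intro conjI impI)
  show cII if cI
    using that locally_euclidean_imp_Homeo_top_not_locally_compact[OF assms(2)]
    unfolding cI_def cII_def by blast
next
  assume cII
  then have met: "metrizable_space X"
    and nlc: "\<And>U. openin X U \<Longrightarrow> U \<noteq> {} \<Longrightarrow> compactin X (X closure_of U) \<Longrightarrow>
                 \<not> locally_compact_space (Homeo_top X (X closure_of U))"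
    unfolding cII_def by auto
  \<comment> \<open>A non-compact space is non-empty, so local compactness provides a non-empty open
    set with compact closure; that closure serves as \<open>M0\<close>.\<close>
  have "topspace X \<noteq> {}"
    using assms(3) compact_space_def by fastforce
  then obtain x where "x \<in> topspace X" by blast
  then obtain U where "openin X U" "compactin X (X closure_of U)" "x \<in> U"
    using assms(1,2) locally_compact_space_compact_closure_of by blast
  then have M0: "\<exists>M0. compactin X M0 \<and> \<not> locally_compact_space (Homeo_top X M0)"
    using nlc by blast
  have lm: "locally_metrizable_space X"
    unfolding locally_metrizable_space_def using met by (metis openin_topspace subtopology_topspace)
  obtain T where "infinite_discrete_closed_in X T"
    using metrizable_noncompact_imp_infinite_discrete_closed[OF met assms(3)] by blast
  then have "\<exists>T. infinite_discrete_closed_in X T \<and>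
                (\<forall>t\<in>T. \<forall>V. neighbourhood_of X V t \<and> compactin X (X closure_of V) \<longrightarrow>
                   Homeo_top X (X closure_of V) \<noteq> discrete_topology (Homeo X (X closure_of V)))"
    using Homeo_top_not_discrete_if_no_locally_compact[OF nlc] by (intro exI[of _ T]) auto
  then show cIII
    unfolding cIII_def by (intro conjI metrizable_imp_normal_space[OF met] lm M0)
next
  assume cIII
  then obtain M0 T where X: "normal_space X" "locally_metrizable_space X"
    and M0: "compactin X M0" "\<not> locally_compact_space (Homeo_top X M0)"
    and T: "infinite_discrete_closed_in X T"
    and nd: "\<forall>t\<in>T. \<forall>V. neighbourhood_of X V t \<and> compactin X (X closure_of V) \<longrightarrow>
                   Homeo_top X (X closure_of V) \<noteq> discrete_topology (Homeo X (X closure_of V))"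
    unfolding cIII_def by blast
  obtain A S where A: "regular_closed_in X A" "sigma_compact_in X A" "metrizable_space (subtopology X A)"
    "S \<subseteq> X interior_of A" "S \<subseteq> T" "infinite_discrete_closed_in X S"
    using discrete_closed_set_in_metrizable_regular_closed_set[OF assms(1,2) X T] by blast
  show cIV
    unfolding cIV_def
  proof
    show "\<exists>M0. compactin X M0 \<and> metrizable_space (subtopology X M0) \<and>
                 \<not> locally_compact_space (Homeo_top X M0)"
      \<comment> \<open>The same \<open>M0\<close> is kept, since local metrizability already makes
        compact subsets metrizable; only \<open>T\<close> is thinned to \<open>S\<close>.\<close>
      using compactin_locally_metrizable_imp_metrizable[OF assms(1,2) X(2) M0(1)] M0 by blast
    show "\<exists>A T. regular_closed_in X A \<and> sigma_compact_in X A \<and>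
                  metrizable_space (subtopology X A) \<and>
                  T \<subseteq> X interior_of A \<and> infinite_discrete_closed_in X T \<and>
                  (\<forall>t\<in>T. \<forall>V. neighbourhood_of X V t \<and> compactin X (X closure_of V) \<longrightarrow>
                     Homeo_top X (X closure_of V) \<noteq> discrete_topology (Homeo X (X closure_of V)))"
      using A nd by (intro exI[of _ A] exI[of _ S] conjI) auto
  qed
next
  assume cIV
  then obtain M0 A T where M0: "compactin X M0" "metrizable_space (subtopology X M0)"
      "\<not> locally_compact_space (Homeo_top X M0)"
    and A: "regular_closed_in X A" "metrizable_space (subtopology X A)"
      "T \<subseteq> X interior_of A" "infinite_discrete_closed_in X T"
    and nd: "\<forall>t\<in>T. \<forall>V. neighbourhood_of X V t \<and> compactin X (X closure_of V) \<longrightarrow>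
                   Homeo_top X (X closure_of V) \<noteq> discrete_topology (Homeo X (X closure_of V))"
    unfolding cIV_def by blast
  have "closedin X A" using A(1) closedin_closure_of by (metis regular_closed_in_def)
  then show cV
    unfolding cV_def
    using not_Homeo_family_ACP_if_discrete_closed_set[OF assms(1,2) M0 _ A(2,3,4)] nd by blast
qed

end
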